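(* Let $N/K$ be a finite Galois extension, and let $L$, $M$, $F$ be fields between $K$ and $N$ such that $F = L.M$ (the compositum of $L$ and $M$ in $N$). Suppose $|\cdot|_K$ is a complete discrete absolute value on $K$ such that $L/K$ is tamely ramified and the residue field extension $\overline{N}/\overline{K}$ is separable. Then $e(N/F) = \gcd(e(N/L), e(N/M))$.
   Context: A discrete absolute value is a non-archimedean absolute value whose value group $|K^*|_K$ is a discrete subgroup of $\mathbb{R}_{>0}$; complete means $K$ is complete with respect to $|\cdot|_K$. There is a unique extension of $|\cdot|_K$ to a (non-archimedean) absolute value $|\cdot|_N$ on $N$, and $\overline{N},\overline{K}$ denote the residue fields of $N$ and $K$ with respect to $|\cdot|_N$ and $|\cdot|_K$. For fields $U,V$ with $K\le V\le U\le N$, the ramification index $e(U/V)$ is the index $[|U^*|_N:|V^*|_N]$ of $|V^*|_N$ in $|U^*|_N$ as subgroups of $\mathbb{R}^*$. $L/K$ is tamely ramified (standard meaning) if the residue field extension $\overline{L}/\overline{K}$ is separable and $e(L/K)$ is not divisible by the characteristic of $\overline{K}$ (no condition on $e(L/K)$ when this characteristic is $0$). *)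

theory Defs
  imports "HOL-Analysis.Analysis" "HOL-Algebra.Algebra"
begin

section \<open>Galois and separable extensions\<close>

text \<open>An extension \<open>E/k\<close> is given by a field \<open>E\<close> (a ring record) and a subfield
  \<open>k\<close> (a subset of its carrier).  An element is separable if it is algebraic and its minimal
  polynomial has only simple roots in an algebraic closure.  For algebraic \<open>E/k\<close> (the only
  case in which all elements can be separable) the algebraic closure of \<open>E\<close> is one of \<open>k\<close>.
  The map \<open>indexed_const\<close> is the embedding of \<open>E\<close> into \<open>alg_closure\<close>.\<close>

definition separable_over :: "('a, 'b) ring_scheme \<Rightarrow> 'a set \<Rightarrow> 'a \<Rightarrow> bool"
  where "separable_over E k x \<longleftrightarrow>
    (ring.algebraic E over k) x \<and>
    (\<forall>a \<in> carrier (field.alg_closure E).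
       ring.alg_mult (field.alg_closure E) (map (ring.indexed_const E) (ring.Irr E k x)) a \<le> 1)"

definition separable_extension :: "('a, 'b) ring_scheme \<Rightarrow> 'a set \<Rightarrow> bool"
  where "separable_extension E k \<longleftrightarrow> (\<forall>x \<in> carrier E. separable_over E k x)"

definition normal_extension :: "('a, 'b) ring_scheme \<Rightarrow> 'a set \<Rightarrow> bool"
  where "normal_extension E k \<longleftrightarrow>
    (\<forall>x \<in> carrier E. (ring.algebraic E over k) x \<and> ring.splitted E (ring.Irr E k x))"

definition finite_galois_extension :: "('a, 'b) ring_scheme \<Rightarrow> 'a set \<Rightarrow> bool"
  where "finite_galois_extension E k \<longleftrightarrow>
    field E \<and> subfield k E \<and> ring.finite_dimension E k (carrier E) \<and>
    normal_extension E k \<and> separable_extension E k"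

definition intermediate_field :: "('a, 'b) ring_scheme \<Rightarrow> 'a set \<Rightarrow> 'a set \<Rightarrow> bool"
  where "intermediate_field E k U \<longleftrightarrow> subfield U E \<and> k \<subseteq> U"

definition compositum :: "('a, 'b) ring_scheme \<Rightarrow> 'a set \<Rightarrow> 'a set \<Rightarrow> 'a set"
  where "compositum E U V = generate_field E (U \<union> V)"

definition ring_characteristic :: "('a, 'b) ring_scheme \<Rightarrow> nat"
  where "ring_characteristic R =
    (if \<exists>n::nat > 0. [n] \<cdot>\<^bsub>R\<^esub> \<one>\<^bsub>R\<^esub> = \<zero>\<^bsub>R\<^esub>
     then LEAST n::nat. n > 0 \<and> [n] \<cdot>\<^bsub>R\<^esub> \<one>\<^bsub>R\<^esub> = \<zero>\<^bsub>R\<^esub>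
     else 0)"


section \<open>Absolute values\<close>

definition nonarch_abs :: "('a, 'b) ring_scheme \<Rightarrow> ('a \<Rightarrow> real) \<Rightarrow> bool"
  where "nonarch_abs R v \<longleftrightarrow>
    (\<forall>x \<in> carrier R. 0 \<le> v x \<and> (v x = 0 \<longleftrightarrow> x = \<zero>\<^bsub>R\<^esub>)) \<and>
    (\<forall>x \<in> carrier R. \<forall>y \<in> carrier R. v (x \<otimes>\<^bsub>R\<^esub> y) = v x * v y) \<and>
    (\<forall>x \<in> carrier R. \<forall>y \<in> carrier R. v (x \<oplus>\<^bsub>R\<^esub> y) \<le> max (v x) (v y))"

definition value_group :: "('a, 'b) ring_scheme \<Rightarrow> ('a \<Rightarrow> real) \<Rightarrow> real monoid"
  where "value_group R v =
    \<lparr> carrier = v ` (carrier R - {\<zero>\<^bsub>R\<^esub>}), monoid.mult = (*), one = 1 \<rparr>"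

text \<open>The value \<open>0\<close> outside the carrier is needed only because the locale
  \<^locale>\<open>Metric_space\<close> demands symmetry and non-negativity on the whole type.\<close>

definition abs_dist :: "('a, 'b) ring_scheme \<Rightarrow> ('a \<Rightarrow> real) \<Rightarrow> 'a \<Rightarrow> 'a \<Rightarrow> real"
  where "abs_dist R v x y =
    (if x \<in> carrier R \<and> y \<in> carrier R then v (x \<ominus>\<^bsub>R\<^esub> y) else 0)"

definition complete_discrete_abs :: "('a, 'b) ring_scheme \<Rightarrow> ('a \<Rightarrow> real) \<Rightarrow> bool"
  where "complete_discrete_abs R v \<longleftrightarrow>
    nonarch_abs R v \<and>
    discrete (carrier (value_group R v)) \<and>
    Metric_space.mcomplete (carrier R) (abs_dist R v)"


section \<open>Residue fields and ramification\<close>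

definition valuation_ring :: "('a, 'b) ring_scheme \<Rightarrow> ('a \<Rightarrow> real) \<Rightarrow> 'a set"
  where "valuation_ring R v = {x \<in> carrier R. v x \<le> 1}"

definition valuation_ideal :: "('a, 'b) ring_scheme \<Rightarrow> ('a \<Rightarrow> real) \<Rightarrow> 'a set"
  where "valuation_ideal R v = {x \<in> carrier R. v x < 1}"

definition residue_field :: "('a, 'b) ring_scheme \<Rightarrow> ('a \<Rightarrow> real) \<Rightarrow> 'a set ring"
  where "residue_field R v =
    (R \<lparr> carrier := valuation_ring R v \<rparr>) Quot (valuation_ideal R v)"

text \<open>From here on \<open>N\<close> is a field, \<open>v\<close> an absolute value on it, and \<open>V \<subseteq> U\<close> are subfields.
  The residue field of \<open>V\<close> is not a subset of that of \<open>U\<close> (cosets of different ideals);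
  \<open>residue_image N v U V\<close> is its image under the canonical embedding
  \<open>x + m\<^sub>V \<mapsto> x + m\<^sub>U\<close>.\<close>

definition residue_image ::
    "('a, 'b) ring_scheme \<Rightarrow> ('a \<Rightarrow> real) \<Rightarrow> 'a set \<Rightarrow> 'a set \<Rightarrow> 'a set set"
  where "residue_image N v U V =
    (\<lambda>x. valuation_ideal (N \<lparr> carrier := U \<rparr>) v +>\<^bsub>N\<^esub> x) ` valuation_ring (N \<lparr> carrier := V \<rparr>) v"

definition residue_separable ::
    "('a, 'b) ring_scheme \<Rightarrow> ('a \<Rightarrow> real) \<Rightarrow> 'a set \<Rightarrow> 'a set \<Rightarrow> bool"
  where "residue_separable N v U V \<longleftrightarrow>
    separable_extension (residue_field (N \<lparr> carrier := U \<rparr>) v) (residue_image N v U V)"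

definition ramification_index ::
    "('a, 'b) ring_scheme \<Rightarrow> ('a \<Rightarrow> real) \<Rightarrow> 'a set \<Rightarrow> 'a set \<Rightarrow> nat"
  where "ramification_index N v U V =
    card (rcosets\<^bsub>value_group (N \<lparr> carrier := U \<rparr>) v\<^esub> carrier (value_group (N \<lparr> carrier := V \<rparr>) v))"

definition tamely_ramified ::
    "('a, 'b) ring_scheme \<Rightarrow> ('a \<Rightarrow> real) \<Rightarrow> 'a set \<Rightarrow> 'a set \<Rightarrow> bool"
  where "tamely_ramified N v U V \<longleftrightarrow>
    residue_separable N v U V \<and>
    (let p = ring_characteristic (residue_field (N \<lparr> carrier := V \<rparr>) v)
     in p \<noteq> 0 \<longrightarrow> \<not> p dvd ramification_index N v U V)"

end

theory Submission
  imports Defs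
begin

text \<open>The value group of \<open>N\<close> is infinite cyclic (unless the absolute value is trivial),
  so a subgroup of finite index is determined by its index: if \<open>L\<close>, \<open>M\<close>,
  \<open>F\<close> have value groups of index \<open>l\<close>, \<open>m\<close>, \<open>f\<close> in that of
  \<open>N\<close>, the subgroup generated by the first two has index \<open>gcd l m\<close>. The assertion
  therefore says that the value group of the compositum \<open>F\<close> is generated by the value groups of
  \<open>L\<close> and \<open>M\<close> (\<open>value_set_tame_compositum\<close>).

  The reason is the structure of tame extensions: \<open>L\<close> arises from \<open>K\<close> by an unramified
  extension followed by the adjunction of a radical \<open>q\<close> whose exponent \<open>e\<close> is a unit.
  Over \<open>M\<close> the unramified part remains unramified and adds no values
  (\<open>value_set_simple_extension\<close>). After enlarging it to a maximal subfield \<open>B\<close> of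
  \<open>F\<close> with the values of \<open>M\<close>, one has \<open>F = B(q)\<close>, and the smallest
  power of \<open>q\<close> whose value comes from \<open>B\<close> even lies in \<open>B\<close>. So the powers
  of \<open>q\<close> below that one are a basis of \<open>F\<close> over \<open>B\<close> with values in
  distinct classes, and the value of \<open>q\<close>, which is a value of \<open>L\<close>, is the only one
  that has to be added (\<open>value_set_radical_extension\<close>).

  All the arithmetic comes from root lifting (\<open>hensel\<close>) in fields between \<open>K\<close> and
  \<open>N\<close>, which are complete because they are finite-dimensional over \<open>K\<close>
  (\<open>complete_on_dimension\<close>), and from the choice of approximating elements: separability of the
  residue extension yields, in each residue class of \<open>L\<close>, a root of a polynomial over
  \<open>K\<close> that is simple modulo the valuation ideal
  (\<open>exists_residually_simple_root_close\<close>); tameness makes one-units \<open>e\<close>-th powers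
  (\<open>exists_root_of_one_unit\<close>).\<close>

section \<open>Polynomials in Horner form\<close>

text \<open>Coefficients are listed from the constant term upwards, opposite to the order of
  \<^const>\<open>ring.eval\<close>, and zero leading coefficients are allowed. A monic polynomial of degree
  \<open>n\<close> is \<open>cs @ [\<one>]\<close> with \<open>length cs = n\<close>; induction on the list
  then peels off the constant term, and reverse induction the leading one.\<close>

primrec (in ring) horner :: "'a list \<Rightarrow> 'a \<Rightarrow> 'a" where
  "horner [] x = \<zero>"
| "horner (c # cs) x = c \<oplus> x \<otimes> horner cs x"

primrec (in ring) horner_deriv :: "'a list \<Rightarrow> 'a \<Rightarrow> 'a" where
  "horner_deriv [] x = \<zero>"
| "horner_deriv (c # cs) x = horner cs x \<oplus> x \<otimes> horner_deriv cs x"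

context ring begin

lemma horner_in_subring:
  assumes "subring S R" "set cs \<subseteq> S" "x \<in> S"
  shows "horner cs x \<in> S"
  using assms(2,3) subringE[OF assms(1)] by (induction cs) auto

lemma horner_deriv_in_subring:
  assumes "subring S R" "set cs \<subseteq> S" "x \<in> S"
  shows "horner_deriv cs x \<in> S"
  using assms(2,3) subringE[OF assms(1)] horner_in_subring[OF assms(1)] by (induction cs) auto

lemmas horner_closed [simp] = horner_in_subring[OF carrier_is_subring]
lemmas horner_deriv_closed [simp] = horner_deriv_in_subring[OF carrier_is_subring]

end

context cring begin

lemma eval_rev_eq_horner:
  assumes "set cs \<subseteq> carrier R" "x \<in> carrier R"
  shows "eval (rev cs) x = horner cs x"
  using assms
  by (induction cs) (auto simp: eval_append_aux a_comm m_comm)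

text \<open>The elementary reduction step: the leading coefficient \<open>t\<close> is removed by subtracting
  \<open>t\<close> times a monic polynomial of the same degree.\<close>

lemma horner_reduce_leading:
  assumes "length us = length hs" "set us \<subseteq> carrier R" "set hs \<subseteq> carrier R"
    "t \<in> carrier R" "x \<in> carrier R"
  defines "ws \<equiv> map2 (\<lambda>u h. u \<ominus> t \<otimes> h) us hs"
  shows "set ws \<subseteq> carrier R"
    "horner (us @ [t]) x = horner ws x \<oplus> t \<otimes> horner (hs @ [\<one>]) x"
    "horner_deriv (us @ [t]) x = horner_deriv ws x \<oplus> t \<otimes> horner_deriv (hs @ [\<one>]) x"
proof -
  have "set ws \<subseteq> carrier R \<and> horner (us @ [t]) x = horner ws x \<oplus> t \<otimes> horner (hs @ [\<one>]) x \<and>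
    horner_deriv (us @ [t]) x = horner_deriv ws x \<oplus> t \<otimes> horner_deriv (hs @ [\<one>]) x"
    using assms(1-3) unfolding ws_def
  proof (induction us hs rule: list_induct2)
    case Nil
    then show ?case using assms(4,5) by auto
  next
    case (Cons u us h hs)
    define zs where "zs = map2 (\<lambda>u h. u \<ominus> t \<otimes> h) us hs"
    have c: "u \<in> carrier R" "h \<in> carrier R" "set zs \<subseteq> carrier R"
      "horner zs x \<in> carrier R" "horner_deriv zs x \<in> carrier R"
      "horner (hs @ [\<one>]) x \<in> carrier R" "horner_deriv (hs @ [\<one>]) x \<in> carrier R"
      using Cons assms(5) by (auto simp: zs_def)
    have eqs: "horner (us @ [t]) x = horner zs x \<oplus> t \<otimes> horner (hs @ [\<one>]) x"
      "horner_deriv (us @ [t]) x = horner_deriv zs x \<oplus> t \<otimes> horner_deriv (hs @ [\<one>]) x"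
      using Cons by (auto simp: zs_def)
    have "u \<oplus> x \<otimes> (horner zs x \<oplus> t \<otimes> horner (hs @ [\<one>]) x) =
      (u \<ominus> t \<otimes> h) \<oplus> x \<otimes> horner zs x \<oplus> t \<otimes> (h \<oplus> x \<otimes> horner (hs @ [\<one>]) x)"
      using c assms(4,5) by algebra
    moreover have "(horner zs x \<oplus> t \<otimes> horner (hs @ [\<one>]) x) \<oplus> x \<otimes> (horner_deriv zs x \<oplus> t \<otimes> horner_deriv (hs @ [\<one>]) x)
      = horner zs x \<oplus> x \<otimes> horner_deriv zs x \<oplus> t \<otimes> (horner (hs @ [\<one>]) x \<oplus> x \<otimes> horner_deriv (hs @ [\<one>]) x)"
      using c assms(4,5) by algebra
    ultimately show ?case using c assms(4) eqs by (auto simp: zs_def)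
  qed
  then show "set ws \<subseteq> carrier R"
    "horner (us @ [t]) x = horner ws x \<oplus> t \<otimes> horner (hs @ [\<one>]) x"
    "horner_deriv (us @ [t]) x = horner_deriv ws x \<oplus> t \<otimes> horner_deriv (hs @ [\<one>]) x"
    by auto
qed

text \<open>Keeping track of the subring in which the remainder lies makes this one identity serve twice: over
  the valuation ring it bounds the remainder, which is what Newton iteration needs; over a polynomial ring,
  evaluated at \<open>X = a + (X - a)\<close>, it exhibits a double root.\<close>

lemma horner_taylor:
  assumes S: "subring S R" and cs: "set cs \<subseteq> S" and x: "x \<in> S" and h: "h \<in> S"
  shows "\<exists>t\<in>S. horner cs (x \<oplus> h) = horner cs x \<oplus> h \<otimes> horner_deriv cs x \<oplus> h \<otimes> h \<otimes> t"
  using cs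
proof (induction cs)
  case Nil
  show ?case using subringE[OF S] h by (intro bexI[of _ \<zero>]) auto
next
  case (Cons c cs)
  note S' = subringE[OF S]
  from Cons obtain t where t: "t \<in> S"
    "horner cs (x \<oplus> h) = horner cs x \<oplus> h \<otimes> horner_deriv cs x \<oplus> h \<otimes> h \<otimes> t" by auto
  let ?t = "horner_deriv cs x \<oplus> x \<otimes> t \<oplus> h \<otimes> t"
  have d: "horner cs x \<in> S" "horner_deriv cs x \<in> S" "c \<in> S"
    using horner_in_subring[OF S] horner_deriv_in_subring[OF S] x Cons by auto
  have "?t \<in> S" using S' t x h d by auto
  moreover have cc: "c \<in> carrier R" "x \<in> carrier R" "h \<in> carrier R" "t \<in> carrier R" "horner cs x \<in> carrier R"
    "horner_deriv cs x \<in> carrier R" using S' t x h d by auto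
  have "horner (c # cs) (x \<oplus> h) = horner (c # cs) x \<oplus> h \<otimes> horner_deriv (c # cs) x \<oplus> h \<otimes> h \<otimes> ?t"
    using cc unfolding horner.simps horner_deriv.simps t(2) by algebra
  ultimately show ?case by blast
qed

lemma horner_deriv_lipschitz:
  assumes S: "subring S R" and cs: "set cs \<subseteq> S" and x: "x \<in> S" and h: "h \<in> S"
  shows "\<exists>t\<in>S. horner_deriv cs (x \<oplus> h) = horner_deriv cs x \<oplus> h \<otimes> t"
  using cs
proof (induction cs)
  case Nil
  show ?case using subringE[OF S] h by (intro bexI[of _ \<zero>]) auto
next
  case (Cons c cs)
  note S' = subringE[OF S]
  from Cons obtain t where t: "t \<in> S"
    "horner_deriv cs (x \<oplus> h) = horner_deriv cs x \<oplus> h \<otimes> t" by auto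
  from horner_taylor[OF S _ x h] Cons obtain u where u: "u \<in> S"
    "horner cs (x \<oplus> h) = horner cs x \<oplus> h \<otimes> horner_deriv cs x \<oplus> h \<otimes> h \<otimes> u" by auto
  have d: "horner cs x \<in> S" "horner_deriv cs x \<in> S"
    using horner_in_subring[OF S] horner_deriv_in_subring[OF S] x Cons by auto
  let ?t = "horner_deriv cs x \<oplus> h \<otimes> u \<oplus> horner_deriv cs x \<oplus> x \<otimes> t \<oplus> h \<otimes> t"
  have "?t \<in> S" using S' t u x h d by auto
  moreover have cc: "x \<in> carrier R" "h \<in> carrier R" "t \<in> carrier R" "u \<in> carrier R"
    "horner cs x \<in> carrier R" "horner_deriv cs x \<in> carrier R" using S' t u x h d by auto
  have "horner_deriv (c # cs) (x \<oplus> h) = horner_deriv (c # cs) x \<oplus> h \<otimes> ?t"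
    using cc unfolding horner_deriv.simps t(2) u(2) by algebra
  ultimately show ?case by blast
qed

text \<open>Long division by a monic polynomial, as an identity of values together with its derivative. The
  derivative identity does not follow from the first one, since the two sides are compared as functions on a
  possibly finite ring; it is carried through the same induction.\<close>

lemma horner_division:
  assumes S: "subring S R" and hs: "set hs \<subseteq> S" and cs: "set cs \<subseteq> S"
  shows "\<exists>qs rs. set qs \<subseteq> S \<and> set rs \<subseteq> S \<and> length rs = length hs \<and>
    (\<forall>x\<in>carrier R. horner cs x = horner (hs @ [\<one>]) x \<otimes> horner qs x \<oplus> horner rs x \<and>
     horner_deriv cs x = horner_deriv (hs @ [\<one>]) x \<otimes> horner qs x
       \<oplus> horner (hs @ [\<one>]) x \<otimes> horner_deriv qs x \<oplus> horner_deriv rs x)"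
  using cs
proof (induction cs)
  case Nil
  note S' = subringE[OF S]
  have z: "horner (replicate n \<zero>) x = \<zero>" "horner_deriv (replicate n \<zero>) x = \<zero>"
    if "x \<in> carrier R" for n x
  proof -
    have "horner (replicate n \<zero>) x = \<zero> \<and> horner_deriv (replicate n \<zero>) x = \<zero>" 
      using that by (induction n) auto
    then show "horner (replicate n \<zero>) x = \<zero>" "horner_deriv (replicate n \<zero>) x = \<zero>" by auto
  qed
  have "set hs \<subseteq> carrier R" using hs S' by auto
  then show ?case using z S' by (intro exI[of _ "[]"] exI[of _ "replicate (length hs) \<zero>"]) auto
next
  case (Cons c cs)
  note S' = subringE[OF S]
  have hsc: "set hs \<subseteq> carrier R" using hs S' by auto
  from Cons obtain qs rs where qr: "set qs \<subseteq> S" "set rs \<subseteq> S" "length rs = length hs"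
    and ev: "\<And>x. x \<in> carrier R \<Longrightarrow> horner cs x = horner (hs @ [\<one>]) x \<otimes> horner qs x \<oplus> horner rs x"
    and dv: "\<And>x. x \<in> carrier R \<Longrightarrow> horner_deriv cs x = horner_deriv (hs @ [\<one>]) x \<otimes> horner qs x
       \<oplus> horner (hs @ [\<one>]) x \<otimes> horner_deriv qs x \<oplus> horner_deriv rs x"
    by auto
  have c: "c \<in> S" using Cons by auto
  obtain us t where ut: "c # rs = us @ [t]" by (metis list.distinct(1) rev_exhaust)
  have l: "length us = length hs" using arg_cong[OF ut, of length] qr by auto
  have "set (us @ [t]) \<subseteq> S" using c qr ut[symmetric] by auto
  then have us: "set us \<subseteq> S" "t \<in> S" by auto
  then have usc: "set us \<subseteq> carrier R" "t \<in> carrier R" using S' by auto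
  define ws where "ws = map2 (\<lambda>u h. u \<ominus> t \<otimes> h) us hs"
  have "set ws \<subseteq> S"
  proof
    fix w assume "w \<in> set ws"
    then obtain u h where "u \<in> set us" "h \<in> set hs" "w = u \<ominus> t \<otimes> h"
      by (auto simp: ws_def dest: set_zip_leftD set_zip_rightD)
    moreover from this have "u \<in> S" "h \<in> S" using us hs by blast+
    ultimately show "w \<in> S" using us(2) S' by (simp add: a_minus_def)
  qed
  moreover have "length ws = length hs" using l by (simp add: ws_def)
  moreover have "horner (c # cs) x = horner (hs @ [\<one>]) x \<otimes> horner (t # qs) x \<oplus> horner ws x"
    "horner_deriv (c # cs) x = horner_deriv (hs @ [\<one>]) x \<otimes> horner (t # qs) x
       \<oplus> horner (hs @ [\<one>]) x \<otimes> horner_deriv (t # qs) x \<oplus> horner_deriv ws x" if x: "x \<in> carrier R" for x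
  proof -
    note comb = horner_reduce_leading[OF l usc(1) hsc usc(2) x, folded ws_def ut]
    have cc: "horner qs x \<in> carrier R" "horner_deriv qs x \<in> carrier R" 
       "horner rs x \<in> carrier R" "horner_deriv rs x \<in> carrier R" 
       "horner ws x \<in> carrier R" "horner_deriv ws x \<in> carrier R" 
      "horner (hs @ [\<one>]) x \<in> carrier R" "horner_deriv (hs @ [\<one>]) x \<in> carrier R" "c \<in> carrier R"
      using qr comb(1) hsc S' x c by (auto intro!: horner_closed horner_deriv_closed)
    have 1: "c \<oplus> x \<otimes> horner rs x = horner ws x \<oplus> t \<otimes> horner (hs @ [\<one>]) x"
      using comb(2) by simp
    have 2: "horner rs x \<oplus> x \<otimes> horner_deriv rs x = horner_deriv ws x \<oplus> t \<otimes> horner_deriv (hs @ [\<one>]) x"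
      using comb(3) by simp
    have "horner (c # cs) x = horner (hs @ [\<one>]) x \<otimes> (x \<otimes> horner qs x) \<oplus> (c \<oplus> x \<otimes> horner rs x)"
      using cc x usc unfolding horner.simps ev[OF x] by algebra
    also have "\<dots> = horner (hs @ [\<one>]) x \<otimes> horner (t # qs) x \<oplus> horner ws x"
      using cc x usc unfolding 1 horner.simps by algebra
    finally show "horner (c # cs) x = horner (hs @ [\<one>]) x \<otimes> horner (t # qs) x \<oplus> horner ws x" .
    have "horner_deriv (c # cs) x =  horner_deriv (hs @ [\<one>]) x \<otimes> (x \<otimes> horner qs x) \<oplus> 
        horner (hs @ [\<one>]) x \<otimes> (horner qs x \<oplus> x \<otimes> horner_deriv qs x) \<oplus> (horner rs x \<oplus> x \<otimes> horner_deriv rs x)"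
      using cc x usc unfolding horner_deriv.simps ev[OF x] dv[OF x] by algebra
    also have "\<dots> = horner_deriv (hs @ [\<one>]) x \<otimes> horner (t # qs) x
       \<oplus> horner (hs @ [\<one>]) x \<otimes> horner_deriv (t # qs) x \<oplus> horner_deriv ws x"
      using cc x usc unfolding 2 horner.simps horner_deriv.simps by algebra
    finally show "horner_deriv (c # cs) x = \<dots>" .
  qed
  ultimately show ?case using us qr by (intro exI[of _ "t # qs"] exI[of _ ws]) auto
qed

end

lemma (in ring_hom_ring) horner_hom:
  assumes "set cs \<subseteq> carrier R" "x \<in> carrier R"
  shows "S.horner (map h cs) (h x) = h (R.horner cs x)"
    "S.horner_deriv (map h cs) (h x) = h (R.horner_deriv cs x)"
proof -
  have "S.horner (map h cs) (h x) = h (R.horner cs x) \<and>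
    S.horner_deriv (map h cs) (h x) = h (R.horner_deriv cs x)"
    using assms by (induction cs) auto
  then show "S.horner (map h cs) (h x) = h (R.horner cs x)"
    "S.horner_deriv (map h cs) (h x) = h (R.horner_deriv cs x)" by auto
qed

context cring begin

lemma horner_snoc:
  assumes "set cs \<subseteq> carrier R" "t \<in> carrier R" "x \<in> carrier R"
  shows "horner (cs @ [t]) x = horner cs x \<oplus> t \<otimes> x [^] length cs"
  using assms(1)
proof (induction cs)
  case Nil
  then show ?case using assms by simp
next
  case (Cons c cs)
  have cc: "c \<in> carrier R" "horner cs x \<in> carrier R" "x [^] length cs \<in> carrier R" using Cons assms by auto
  have "c \<oplus> x \<otimes> (horner cs x \<oplus> t \<otimes> x [^] length cs) = (c \<oplus> x \<otimes> horner cs x) \<oplus> t \<otimes> (x [^] length cs \<otimes> x)"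
    using cc assms by algebra
  then show ?case using Cons by simp
qed

lemma horner_scale:
  assumes "set cs \<subseteq> carrier R" "a \<in> carrier R" "x \<in> carrier R"
  shows "horner (map ((\<otimes>) a) cs) x = a \<otimes> horner cs x"
  using assms(1)
proof (induction cs)
  case Nil
  then show ?case using assms by simp
next
  case (Cons c cs)
  have cc: "c \<in> carrier R" "horner cs x \<in> carrier R" using Cons assms by auto
  have "a \<otimes> c \<oplus> x \<otimes> (a \<otimes> horner cs x) = a \<otimes> (c \<oplus> x \<otimes> horner cs x)"
    using cc assms by algebra
  then show ?case using Cons by simp
qed

text \<open>Reduction modulo a monic polynomial that vanishes at \<open>x\<close>.\<close>

lemma simple_extension_eq_horner:
  assumes C: "subring C R" and hs: "set hs \<subseteq> C" and x: "x \<in> carrier R"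
    and root: "horner (hs @ [\<one>]) x = \<zero>" and z: "z \<in> simple_extension C x"
  shows "\<exists>cs. set cs \<subseteq> C \<and> length cs = length hs \<and> horner cs x = z"
  using z
proof (induction rule: simple_extension.induct)
  case zero
  have "horner (replicate n \<zero>) x = \<zero>" for n using x by (induction n) auto
  then show ?case using subringE[OF C] by (intro exI[of _ "replicate (length hs) \<zero>"]) auto
next
  case (lin z c)
  note C' = subringE[OF C]
  obtain cs where cs: "set cs \<subseteq> C" "length cs = length hs" "horner cs x = z" using lin by auto
  obtain us t where ut: "c # cs = us @ [t]" by (metis list.distinct(1) rev_exhaust)
  have l: "length us = length hs" using arg_cong[OF ut, of length] cs by auto
  have "set (us @ [t]) \<subseteq> C" using cs lin ut[symmetric] by auto
  then have us: "set us \<subseteq> C" "t \<in> C" by auto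
  then have usc: "set us \<subseteq> carrier R" "t \<in> carrier R" "set hs \<subseteq> carrier R" 
    "c \<in> carrier R" "set cs \<subseteq> carrier R" using C' hs lin cs by auto
  define ws where "ws = map2 (\<lambda>u h. u \<ominus> t \<otimes> h) us hs"
  note comb = horner_reduce_leading[OF l usc(1,3,2) x, folded ws_def ut]
  have "set ws \<subseteq> C"
  proof
    fix w assume "w \<in> set ws"
    then obtain u h where "u \<in> set us" "h \<in> set hs" "w = u \<ominus> t \<otimes> h"
      by (auto simp: ws_def dest: set_zip_leftD set_zip_rightD)
    moreover from this have "u \<in> C" "h \<in> C" using us hs by blast+
    ultimately show "w \<in> C" using us(2) C' by (simp add: a_minus_def)
  qed
  moreover have "horner ws x = z \<otimes> x \<oplus> c"
  proof -
    have "horner (c # cs) x = horner ws x" using comb(1,2) usc x by (simp add: root)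
    moreover have "horner (c # cs) x = z \<otimes> x \<oplus> c"
      using cs(3) usc x horner_closed[OF usc(5) x] by (auto simp: a_comm m_comm)
    ultimately show ?thesis by simp
  qed
  moreover have "length ws = length hs" using l by (simp add: ws_def)
  ultimately show ?case by blast
qed

end

context cring begin

lemma horner_binomial:
  assumes "0 < n" "a \<in> carrier R" "x \<in> carrier R"
  shows "horner (\<ominus> a # replicate (n - 1) \<zero> @ [\<one>]) x = x [^] n \<ominus> a"
    "horner_deriv (\<ominus> a # replicate (n - 1) \<zero> @ [\<one>]) x = ([n] \<cdot> \<one>) \<otimes> x [^] (n - 1)"
proof -
  have z: "horner (replicate k \<zero> @ [\<one>]) x = x [^] k" for k
    using assms by (induction k) (auto simp: m_comm)
  have dz: "x \<otimes> horner_deriv (replicate k \<zero> @ [\<one>]) x = ([k] \<cdot> \<one>) \<otimes> x [^] k" for k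
  proof (induction k)
    case 0
    show ?case using assms by simp
  next
    case (Suc k)
    define P where "P = x [^] k"
    define N where "N = [k] \<cdot> \<one>"
    have PN: "P \<in> carrier R" "N \<in> carrier R" using assms by (auto simp: P_def N_def)
    have "x \<otimes> (P \<oplus> N \<otimes> P) = (N \<oplus> \<one>) \<otimes> (P \<otimes> x)" using PN assms(3) by algebra
    then show ?case using Suc assms by (simp add: z P_def N_def add.nat_pow_Suc)
  qed
  obtain k where k: "n = Suc k" using assms(1) by (cases n) auto
  have c: "x [^] k \<in> carrier R" "[k] \<cdot> \<one> \<in> carrier R" using assms by auto
  show "horner (\<ominus> a # replicate (n - 1) \<zero> @ [\<one>]) x = x [^] n \<ominus> a"
    using assms(2,3) c by (simp add: k z a_minus_def a_comm m_comm)
  have "x [^] k \<oplus> ([k] \<cdot> \<one>) \<otimes> x [^] k = ([k] \<cdot> \<one> \<oplus> \<one>) \<otimes> x [^] k"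
    using c by algebra
  then show "horner_deriv (\<ominus> a # replicate (n - 1) \<zero> @ [\<one>]) x = ([n] \<cdot> \<one>) \<otimes> x [^] (n - 1)"
    by (simp add: k z dz)
qed

lemma ring_characteristic_dvd:
  assumes "0 < n" "[n] \<cdot> \<one> = \<zero>"
  shows "ring_characteristic R \<noteq> 0" "ring_characteristic R dvd n"
proof -
  define P where "P = (\<lambda>n::nat. n > 0 \<and> [n] \<cdot> \<one> = \<zero>)"
  define p where "p = (LEAST n. P n)"
  have "P n" using assms by (simp add: P_def)
  then have p: "P p" unfolding p_def by (rule LeastI)
  have "\<exists>n::nat>0. [n] \<cdot> \<one> = \<zero>" using assms by blast
  then have eq: "ring_characteristic R = p"
    unfolding ring_characteristic_def p_def P_def by simp
  show "ring_characteristic R \<noteq> 0" using p eq by (simp add: P_def)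
  have p0: "[p] \<cdot> \<one> = \<zero>" using p by (simp add: P_def)
  have "[n] \<cdot> \<one> = [(n div p * p)] \<cdot> \<one> \<oplus> [(n mod p)] \<cdot> \<one>"
    by (simp add: add.nat_pow_mult)
  also have "[(n div p * p)] \<cdot> \<one> = [(n div p)] \<cdot> ([p] \<cdot> \<one>)"
    by (simp add: add.nat_pow_pow mult.commute)
  also have "\<dots> = \<zero>" by (simp add: p0)
  finally have "[(n mod p)] \<cdot> \<one> = \<zero>" using assms by simp
  then have "\<not> 0 < n mod p" using not_less_Least[of "n mod p" P] p
    unfolding p_def[symmetric] by (auto simp: P_def)
  then show "ring_characteristic R dvd n" unfolding eq by (simp add: mod_greater_zero_iff_not_dvd)
qed

end

section \<open>Ultrametric fields and root lifting\<close>

locale ultrametric_field = field R for R (structure) +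
  fixes v :: "'a \<Rightarrow> real"
  assumes nonarch: "nonarch_abs R v"
begin

lemma minus_self [simp]: "x \<in> carrier R \<Longrightarrow> x \<ominus> x = \<zero>"
  by simp

lemma v_nonneg [simp]: "x \<in> carrier R \<Longrightarrow> 0 \<le> v x"
  and v_eq_0_iff [simp]: "x \<in> carrier R \<Longrightarrow> v x = 0 \<longleftrightarrow> x = \<zero>"
  and v_mult [simp]: "x \<in> carrier R \<Longrightarrow> y \<in> carrier R \<Longrightarrow> v (x \<otimes> y) = v x * v y"
  and v_add_le_max: "x \<in> carrier R \<Longrightarrow> y \<in> carrier R \<Longrightarrow> v (x \<oplus> y) \<le> max (v x) (v y)"
  using nonarch by (auto simp: nonarch_abs_def)

lemma v_zero [simp]: "v \<zero> = 0"
  by simp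

lemma v_pos_iff [simp]: "x \<in> carrier R \<Longrightarrow> 0 < v x \<longleftrightarrow> x \<noteq> \<zero>"
  using v_nonneg[of x] v_eq_0_iff[of x] by linarith

lemma v_one [simp]: "v \<one> = 1"
proof -
  have "v \<one> * v \<one> = v \<one>" using v_mult[of \<one> \<one>] by simp
  then show ?thesis using v_eq_0_iff[of \<one>] by simp
qed

lemma v_uminus [simp]:
  assumes "x \<in> carrier R"
  shows "v (\<ominus> x) = v x"
proof -
  have "v (\<ominus> x) * v (\<ominus> x) = v x * v x"
    using assms by (simp add: l_minus r_minus flip: v_mult)
  then have "(v (\<ominus> x))\<^sup>2 = (v x)\<^sup>2" by (simp add: power2_eq_square)
  then show ?thesis using assms by (simp add: power2_eq_iff_nonneg)
qed

lemma v_minus_le_max: "x \<in> carrier R \<Longrightarrow> y \<in> carrier R \<Longrightarrow> v (x \<ominus> y) \<le> max (v x) (v y)"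
  using v_add_le_max[of x "\<ominus> y"] by (simp add: a_minus_def)

lemma v_minus_commute: "x \<in> carrier R \<Longrightarrow> y \<in> carrier R \<Longrightarrow> v (x \<ominus> y) = v (y \<ominus> x)"
  using v_uminus[of "x \<ominus> y"] by (simp add: minus_add a_minus_def a_comm)

lemma v_pow [simp]: "x \<in> carrier R \<Longrightarrow> v (x [^] (n::nat)) = v x ^ n"
  by (induction n) auto

lemma v_inv [simp]:
  assumes "x \<in> carrier R" "x \<noteq> \<zero>"
  shows "v (inv x) = inverse (v x)"
proof -
  have "v x * v (inv x) = 1"
    using assms by (simp add: field_Units flip: v_mult)
  then show ?thesis by (metis inverse_unique)
qed

lemma inv_carrier [simp]: "x \<in> carrier R \<Longrightarrow> x \<noteq> \<zero> \<Longrightarrow> inv x \<in> carrier R"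
  by (simp add: field_Units)

lemma mult_inv_cancel [simp]: "x \<in> carrier R \<Longrightarrow> x \<noteq> \<zero> \<Longrightarrow> x \<otimes> inv x = \<one>"
  "x \<in> carrier R \<Longrightarrow> x \<noteq> \<zero> \<Longrightarrow> inv x \<otimes> x = \<one>"
  by (simp_all add: field_Units)

lemma v_add_eq_right:
  assumes "x \<in> carrier R" "y \<in> carrier R" "v x < v y"
  shows "v (x \<oplus> y) = v y"
proof (rule antisym)
  show "v (x \<oplus> y) \<le> v y" using v_add_le_max[of x y] assms by simp
  have "y = (x \<oplus> y) \<ominus> x" using assms by algebra
  then have "v y \<le> max (v (x \<oplus> y)) (v x)" using v_minus_le_max[of "x \<oplus> y" x] assms by simp
  then show "v y \<le> v (x \<oplus> y)" using assms by simp
qed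

lemma v_eq_if_close:
  assumes "x \<in> carrier R" "y \<in> carrier R" "v (x \<ominus> y) < v y"
  shows "v x = v y"
proof -
  have "x = (x \<ominus> y) \<oplus> y" using assms by algebra
  then show ?thesis using v_add_eq_right[of "x \<ominus> y" y] assms by simp
qed

lemma v_triangle:
  assumes "x \<in> carrier R" "y \<in> carrier R" "z \<in> carrier R"
  shows "v (x \<ominus> z) \<le> max (v (x \<ominus> y)) (v (y \<ominus> z))"
proof -
  have "x \<ominus> z = (x \<ominus> y) \<oplus> (y \<ominus> z)" using assms by algebra
  then show ?thesis using v_add_le_max[of "x \<ominus> y" "y \<ominus> z"] assms by simp
qed

lemma mem_valuation_ring: "x \<in> valuation_ring R v \<longleftrightarrow> x \<in> carrier R \<and> v x \<le> 1"
  by (simp add: valuation_ring_def)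

lemma subring_valuation_ring: "subring (valuation_ring R v) R"
proof (rule subringI)
  show "h1 \<oplus> h2 \<in> valuation_ring R v" if "h1 \<in> valuation_ring R v" "h2 \<in> valuation_ring R v" for h1 h2
    using v_add_le_max[of h1 h2] that by (auto simp: mem_valuation_ring)
qed (auto simp: mem_valuation_ring mult_le_one)

lemma v_horner_le_1:
  assumes "set cs \<subseteq> valuation_ring R v" "x \<in> valuation_ring R v"
  shows "v (horner cs x) \<le> 1" "v (horner_deriv cs x) \<le> 1"
  using horner_in_subring[OF subring_valuation_ring assms]
    horner_deriv_in_subring[OF subring_valuation_ring assms] by (auto simp: mem_valuation_ring)

lemma v_horner_diff_le:
  assumes cs: "set cs \<subseteq> valuation_ring R v" and x: "x \<in> valuation_ring R v" and y: "y \<in> valuation_ring R v"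
  shows "v (horner cs y \<ominus> horner cs x) \<le> v (y \<ominus> x)"
    "v (horner_deriv cs y \<ominus> horner_deriv cs x) \<le> v (y \<ominus> x)"
proof -
  note S = subring_valuation_ring
  define h where "h = y \<ominus> x"
  have cc: "x \<in> carrier R" "y \<in> carrier R" "set cs \<subseteq> carrier R"
    using assms by (auto simp: mem_valuation_ring)
  have h: "h \<in> valuation_ring R v" "h \<in> carrier R" and yh: "y = x \<oplus> h"
    using subringE(5)[OF S] subringE(7)[OF S] x y cc unfolding h_def by (auto simp: a_minus_def, algebra)
  have d: "horner cs x \<in> carrier R" "horner_deriv cs x \<in> carrier R" using cc by auto
  obtain t where t: "t \<in> valuation_ring R v"
    "horner cs (x \<oplus> h) = horner cs x \<oplus> h \<otimes> horner_deriv cs x \<oplus> h \<otimes> h \<otimes> t"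
    using horner_taylor[OF S cs x h(1)] by auto
  obtain u where u: "u \<in> valuation_ring R v"
    "horner_deriv cs (x \<oplus> h) = horner_deriv cs x \<oplus> h \<otimes> u"
    using horner_deriv_lipschitz[OF S cs x h(1)] by auto
  have tu: "t \<in> carrier R" "u \<in> carrier R" using t u by (auto simp: mem_valuation_ring)
  have "horner cs y \<ominus> horner cs x = h \<otimes> (horner_deriv cs x \<oplus> h \<otimes> t)"
    using tu d h unfolding yh t by algebra
  moreover have "horner_deriv cs x \<oplus> h \<otimes> t \<in> valuation_ring R v"
    using subringE[OF S] t h horner_deriv_in_subring[OF S cs x] by auto
  ultimately show "v (horner cs y \<ominus> horner cs x) \<le> v (y \<ominus> x)"
    using h by (auto simp: mem_valuation_ring h_def[symmetric] mult_left_le)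
  have "horner_deriv cs y \<ominus> horner_deriv cs x = h \<otimes> u"
    using tu d h unfolding yh u by algebra
  then show "v (horner_deriv cs y \<ominus> horner_deriv cs x) \<le> v (y \<ominus> x)"
    using h u by (auto simp: mem_valuation_ring h_def[symmetric] mult_left_le)
qed

text \<open>By Taylor expansion \<open>f(x + h) = h (f'(x) + h t)\<close>, and the second factor has
  value 1 when \<open>h\<close> has value less than 1.\<close>

lemma simple_root_unique:
  assumes cs: "set cs \<subseteq> valuation_ring R v" and x: "x \<in> valuation_ring R v" and y: "y \<in> valuation_ring R v"
    and root: "horner cs x = \<zero>" "horner cs y = \<zero>" and simple: "v (horner_deriv cs x) = 1"
    and close: "v (y \<ominus> x) < 1"
  shows "y = x"
proof -
  note S = subring_valuation_ring
  define h where "h = y \<ominus> x"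
  have cc: "x \<in> carrier R" "y \<in> carrier R" "set cs \<subseteq> carrier R"
    using assms by (auto simp: mem_valuation_ring)
  have h: "h \<in> valuation_ring R v" "h \<in> carrier R" and yh: "y = x \<oplus> h"
    using subringE(5)[OF S] subringE(7)[OF S] x y cc unfolding h_def by (auto simp: a_minus_def, algebra)
  obtain t where t: "t \<in> valuation_ring R v"
    "horner cs (x \<oplus> h) = horner cs x \<oplus> h \<otimes> horner_deriv cs x \<oplus> h \<otimes> h \<otimes> t"
    using horner_taylor[OF S cs x h(1)] by auto
  have tc: "t \<in> carrier R" "v t \<le> 1" using t by (auto simp: mem_valuation_ring)
  have d: "horner_deriv cs x \<in> carrier R" using cc by auto
  have "h \<otimes> (h \<otimes> t \<oplus> horner_deriv cs x) = horner cs y \<ominus> horner cs x"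
    using tc h d unfolding yh t root(1) by algebra
  then have "h \<otimes> (h \<otimes> t \<oplus> horner_deriv cs x) = \<zero>" by (simp add: root)
  moreover have "v (h \<otimes> t) < 1"
    using h tc close mult_left_le[of "v t" "v h"] by (simp add: h_def[symmetric])
  then have "v (h \<otimes> t \<oplus> horner_deriv cs x) = 1"
    using v_add_eq_right[of "h \<otimes> t" "horner_deriv cs x"] h tc d simple by simp
  ultimately have "h = \<zero>"
    using h tc d by (metis integral_iff v_zero zero_neq_one a_closed m_closed)
  then show ?thesis using yh cc by simp
qed

text \<open>The convergence notions are phrased with \<open>v (x \<ominus> y)\<close> directly: the carrier
  need not be the whole type, and completeness is needed for many subsets of it.\<close>

definition cauchy_seq :: "(nat \<Rightarrow> 'a) \<Rightarrow> bool" where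
  "cauchy_seq s \<longleftrightarrow> (\<forall>e>0. \<exists>n0. \<forall>m\<ge>n0. \<forall>n\<ge>n0. v (s m \<ominus> s n) < e)"

definition complete_on :: "'a set \<Rightarrow> bool" where
  "complete_on E \<longleftrightarrow> (\<forall>s. range s \<subseteq> E \<and> cauchy_seq s \<longrightarrow> (\<exists>l\<in>E. (\<lambda>n. v (s n \<ominus> l)) \<longlonglongrightarrow> 0))"

lemma convergent_imp_cauchy_seq:
  assumes "range s \<subseteq> carrier R" "l \<in> carrier R" "(\<lambda>n. v (s n \<ominus> l)) \<longlonglongrightarrow> 0"
  shows "cauchy_seq s"
  unfolding cauchy_seq_def
proof (intro allI impI)
  fix e :: real assume "e > 0"
  then have "\<forall>\<^sub>F n in sequentially. v (s n \<ominus> l) < e" using assms(3) by (rule order_tendstoD(2)[rotated])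
  then obtain n0 where n0: "\<And>n. n \<ge> n0 \<Longrightarrow> v (s n \<ominus> l) < e" by (auto simp: eventually_sequentially)
  have "v (s m \<ominus> s n) < e" if "m \<ge> n0" "n \<ge> n0" for m n
    using v_triangle[of "s m" l "s n"] n0[OF that(1)] n0[OF that(2)] assms v_minus_commute[of l "s n"]
    by (auto simp: range_subsetD)
  then show "\<exists>n0. \<forall>m\<ge>n0. \<forall>n\<ge>n0. v (s m \<ominus> s n) < e" by blast
qed

lemma limit_unique:
  assumes "range s \<subseteq> carrier R" "l \<in> carrier R" "l' \<in> carrier R"
    "(\<lambda>n. v (s n \<ominus> l)) \<longlonglongrightarrow> 0" "(\<lambda>n. v (s n \<ominus> l')) \<longlonglongrightarrow> 0"
  shows "l = l'"
proof -
  have "(\<lambda>n. max (v (s n \<ominus> l)) (v (s n \<ominus> l'))) \<longlonglongrightarrow> max 0 0"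
    by (intro tendsto_max assms)
  moreover have "v (l \<ominus> l') \<le> max (v (s n \<ominus> l)) (v (s n \<ominus> l'))" for n
    using v_triangle[of l "s n" l'] v_minus_commute[of l "s n"] assms by (auto simp: range_subsetD)
  ultimately have "v (l \<ominus> l') \<le> 0" by (intro LIMSEQ_le_const[of _ 0]) auto
  then have "l \<ominus> l' = \<zero>"
    using v_nonneg[of "l \<ominus> l'"] v_eq_0_iff[of "l \<ominus> l'"] minus_closed[OF assms(2,3)] by linarith
  then show ?thesis using assms(2,3) r_right_minus_eq by blast
qed

lemma cauchy_seqI_geometric:
  assumes s: "range s \<subseteq> carrier R" and e: "0 \<le> e" "e < 1"
    and step: "\<And>n. v (s (Suc n) \<ominus> s n) \<le> e ^ n"
  shows "cauchy_seq s"
proof -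
  have *: "v (s (m + k) \<ominus> s m) \<le> e ^ m" for m k
  proof (induction k)
    case 0
    have "s m \<ominus> s m = \<zero>" using s by (intro minus_self) auto
    then show ?case using e by simp
  next
    case (Suc k)
    have "v (s (m + Suc k) \<ominus> s m) \<le> max (v (s (Suc (m + k)) \<ominus> s (m + k))) (v (s (m + k) \<ominus> s m))"
      using v_triangle[of "s (m + Suc k)" "s (m + k)" "s m"] s by (auto simp: range_subsetD)
    also have "\<dots> \<le> e ^ m"
      using Suc order_trans[OF step[of "m + k"] power_decreasing[of m "m + k" e]] e by auto
    finally show ?case .
  qed
  show "cauchy_seq s"
    unfolding cauchy_seq_def
  proof (intro allI impI)
    fix d :: real assume "d > 0"
    then obtain n0 where n0: "e ^ n0 < d" using real_arch_pow_inv[of d e] e by auto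
    have "v (s m \<ominus> s n) < d" if "m \<ge> n0" "n \<ge> n0" for m n
      using v_triangle[of "s m" "s n0" "s n"] *[of n0 "m - n0"] *[of n0 "n - n0"] that n0 s 
        v_minus_commute[of "s n0" "s n"] by (auto simp: range_subsetD)
    then show "\<exists>n0. \<forall>m\<ge>n0. \<forall>n\<ge>n0. v (s m \<ominus> s n) < d" by blast
  qed
qed

text \<open>Newton iteration: with \<open>e = |f(x)| < 1\<close>, the value of \<open>f\<close> shrinks at
  least by the factor \<open>e\<close> in every step while \<open>|f'|\<close> stays 1, so the iterates form a
  Cauchy sequence.\<close>

lemma hensel:
  assumes C: "subfield C R" "complete_on C"
    and cs: "set cs \<subseteq> C \<inter> valuation_ring R v" and x: "x \<in> C \<inter> valuation_ring R v"
    and small: "v (horner cs x) < 1" and simple: "v (horner_deriv cs x) = 1"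
  shows "\<exists>y \<in> C \<inter> valuation_ring R v. horner cs y = \<zero> \<and> v (y \<ominus> x) < 1"
proof -
  note C' = subringE[OF subfieldE(1)[OF C(1)]]
  note S = subring_valuation_ring
  define S0 where "S0 = C \<inter> valuation_ring R v"
  have S0: "subring S0 R" using subring_inter[OF subfieldE(1)[OF C(1)] S] by (simp add: S0_def)
  have car: "y \<in> carrier R" "v y \<le> 1" "y \<in> C" if "y \<in> S0" for y
    using that by (auto simp: S0_def mem_valuation_ring)
  have csS: "set cs \<subseteq> S0" "set cs \<subseteq> carrier R" "set cs \<subseteq> valuation_ring R v"
    using cs by (auto simp: S0_def mem_valuation_ring)
  define e where "e = v (horner cs x)"
  define step where "step = (\<lambda>y. y \<oplus> \<ominus> (horner cs y \<otimes> inv (horner_deriv cs y)))"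
  define s where "s = (\<lambda>n. (step ^^ n) x)"
  have e: "0 \<le> e" "e < 1" using csS x small by (auto simp: e_def mem_valuation_ring)
  have s0: "s 0 = x" and sSuc: "s (Suc n) = step (s n)" for n by (auto simp: s_def)
  have step: "step y \<in> S0 \<and> v (horner cs (step y)) \<le> e ^ Suc (Suc n) \<and> v (horner_deriv cs (step y)) = 1
    \<and> v (step y \<ominus> y) \<le> e ^ Suc n"
    if y: "y \<in> S0" "v (horner cs y) \<le> e ^ Suc n" "v (horner_deriv cs y) = 1" for y n
  proof -
    let ?d = "horner_deriv cs y"
    define h where "h = \<ominus> (horner cs y \<otimes> inv ?d)"
    have yc: "y \<in> carrier R" using car y by blast
    have d: "?d \<in> S0" "?d \<in> carrier R" "horner cs y \<in> S0" "horner cs y \<in> carrier R"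
      using horner_deriv_in_subring[OF S0 csS(1) y(1)] horner_in_subring[OF S0 csS(1) y(1)] car(1) by blast+
    have d0: "?d \<noteq> \<zero>" using y(3) by (metis v_zero zero_neq_one)
    have i: "inv ?d \<in> S0"
      using subfield_m_inv(1)[OF C(1), of ?d] car(3)[OF d(1)] d d0 y(3)
      by (simp add: S0_def mem_valuation_ring)
    have h: "h \<in> S0" using subringE[OF S0] i d by (auto simp: h_def)
    have hc: "h \<in> carrier R" using car h by auto
    have vh: "v h = v (horner cs y)" using d d0 y(3) by (simp add: h_def)
    have st: "step y = y \<oplus> h" by (simp add: step_def h_def)
    obtain t where t: "t \<in> S0" 
      "horner cs (y \<oplus> h) = horner cs y \<oplus> h \<otimes> horner_deriv cs y \<oplus> h \<otimes> h \<otimes> t"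
      using horner_taylor[OF S0 csS(1) y(1) h] by auto
    have "h \<otimes> ?d = \<ominus> horner cs y"
      using d d0 unfolding h_def by (simp add: l_minus m_assoc)
    then have "horner cs (y \<oplus> h) = h \<otimes> h \<otimes> t"
      unfolding t using car(1)[OF t(1)] d hc by (simp add: r_neg)
    then have "v (horner cs (y \<oplus> h)) = v h * v h * v t" using hc car(1)[OF t(1)] by simp
    also have "\<dots> \<le> v h * v h" using car(1,2)[OF t(1)] hc by (intro mult_left_le) auto
    also have "\<dots> \<le> e ^ Suc n * e ^ Suc n" using d y(2) vh e by (intro mult_mono) auto
    also have "\<dots> \<le> e ^ Suc (Suc n)" 
      unfolding power_add[symmetric] using e by (intro power_decreasing) auto
    finally have 1: "v (horner cs (step y)) \<le> e ^ Suc (Suc n)" by (simp add: st)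
    have yh: "step y \<in> S0" using st h y subringE[OF S0] by auto
    have "step y \<ominus> y = h" unfolding st using hc yc by algebra
    then have 3: "v (step y \<ominus> y) \<le> e ^ Suc n" using vh y by simp
    also have "e ^ Suc n < 1" using e power_Suc_less_one[of e] by (cases "e = 0") auto
    finally have "v (step y \<ominus> y) < 1" .
    then have "v (horner_deriv cs (step y) \<ominus> ?d) < v ?d" 
      using v_horner_diff_le(2)[OF csS(3), of y "step y"] y yh by (auto simp: S0_def)
    then have "v (horner_deriv cs (step y)) = 1"
      using v_eq_if_close[of "horner_deriv cs (step y)" ?d] y yh d car csS by auto
    then show ?thesis using 1 3 yh by auto
  qed
  have inv: "s n \<in> S0 \<and> v (horner cs (s n)) \<le> e ^ Suc n \<and> v (horner_deriv cs (s n)) = 1" for n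
  proof (induction n)
    case 0
    then show ?case using x simple by (auto simp: s0 e_def S0_def)
  next
    case (Suc n)
    then show ?case using step[of "s n" n] by (auto simp: sSuc)
  qed
  have "v (s (Suc n) \<ominus> s n) \<le> e ^ Suc n" for n
    using step[of "s n" n] inv[of n] by (auto simp: sSuc)
  then have "v (s (Suc n) \<ominus> s n) \<le> e ^ n" for n
    using power_decreasing[of n "Suc n" e] e by (meson order.trans le_SucI le_refl less_imp_le)
  moreover have rs: "range s \<subseteq> S0" "range s \<subseteq> carrier R" using inv car by auto
  ultimately have cau: "cauchy_seq s" using cauchy_seqI_geometric[of s e] e by auto
  have close: "v (s n \<ominus> x) \<le> e" for n
  proof (induction n)
    case 0
    then show ?case using x e by (auto simp: s0 mem_valuation_ring)
  next
    case (Suc n)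
    have "v (s (Suc n) \<ominus> s n) \<le> e ^ Suc n" 
      using step[of "s n" n] inv[of n] by (auto simp: sSuc)
    also have "\<dots> \<le> e" using e power_decreasing[of 1 "Suc n" e] by simp
    finally show ?case using Suc v_triangle[of "s (Suc n)" "s n" x] rs x 
      by (auto simp: mem_valuation_ring range_subsetD)
  qed
  obtain l where l: "l \<in> C" "(\<lambda>n. v (s n \<ominus> l)) \<longlonglongrightarrow> 0"
    using C(2) cau rs unfolding complete_on_def S0_def by blast
  have lc: "l \<in> carrier R" using l C' by auto
  have "\<forall>\<^sub>F n in sequentially. v (s n \<ominus> l) < 1" using l(2) by (rule order_tendstoD(2)) simp
  then obtain n where n: "v (s n \<ominus> l) < 1" by (auto simp: eventually_sequentially)
  have snl: "v (l \<ominus> s n) < 1" using n v_minus_commute[of l "s n"] lc rs by (auto simp: range_subsetD)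
  have "v (l \<ominus> x) < 1"
    using v_triangle[of l "s n" x] close[of n] e rs lc x snl by (auto simp: range_subsetD mem_valuation_ring)
  moreover have "l \<in> valuation_ring R v"
  proof -
    have "s n \<in> carrier R" using rs by auto
    with lc have "l = (l \<ominus> s n) \<oplus> s n" by algebra
    then have "v l \<le> max (v (l \<ominus> s n)) (v (s n))" 
      using v_add_le_max[of "l \<ominus> s n" "s n"] lc rs by (auto simp: range_subsetD)
    then show ?thesis using snl inv[of n] car(2)[of "s n"] lc by (auto simp: mem_valuation_ring)
  qed
  moreover have "horner cs l = \<zero>"
  proof -
    have hl: "horner cs l \<in> carrier R" using lc csS by auto
    have "v (horner cs l) \<le> max (v (s n \<ominus> l)) (e ^ Suc n)" for n
    proof -
      have sn: "s n \<in> carrier R" "s n \<in> valuation_ring R v" using inv[of n] car by (auto simp: S0_def)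
      have hs: "horner cs (s n) \<in> carrier R" using sn csS by auto
      have "horner cs l = horner cs (s n) \<ominus> (horner cs (s n) \<ominus> horner cs l)"
        using hs hl by algebra
      then have "v (horner cs l) \<le> max (v (horner cs (s n))) (v (horner cs (s n) \<ominus> horner cs l))"
        using v_minus_le_max[of "horner cs (s n)" "horner cs (s n) \<ominus> horner cs l"] hs hl by simp
      also have "\<dots> \<le> max (e ^ Suc n) (v (s n \<ominus> l))"
        using inv[of n] v_horner_diff_le(1)[OF csS(3) \<open>l \<in> valuation_ring R v\<close> sn(2)]
        by (intro max.mono) auto
      finally show ?thesis by (simp add: max.commute)
    qed
    moreover have "(\<lambda>n. max (v (s n \<ominus> l)) (e ^ Suc n)) \<longlonglongrightarrow> max 0 0"
      by (intro tendsto_max l LIMSEQ_Suc LIMSEQ_realpow_zero e)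
    ultimately have "v (horner cs l) \<le> 0" by (intro LIMSEQ_le_const[of _ 0]) auto
    then show ?thesis using hl v_nonneg[OF hl] v_eq_0_iff[OF hl] by linarith
  qed
  ultimately show ?thesis using l(1) by blast
qed

end

section \<open>Value groups\<close>

context ultrametric_field begin

lemma v_horner_deriv_lt_1:
  assumes "\<And>c. c \<in> set cs \<Longrightarrow> c \<in> carrier R \<and> v c < 1" and x: "x \<in> valuation_ring R v"
  shows "v (horner cs x) < 1 \<and> v (horner_deriv cs x) < 1"
  using assms(1)
proof (induction cs)
  case Nil
  show ?case by simp
next
  case (Cons c cs)
  have x': "x \<in> carrier R" "v x \<le> 1" using x by (auto simp: mem_valuation_ring)
  have c: "c \<in> carrier R" "v c < 1" "set cs \<subseteq> carrier R" using Cons(2) by auto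
  have IH: "v (horner cs x) < 1" "v (horner_deriv cs x) < 1" using Cons by auto
  have cc: "horner cs x \<in> carrier R" "horner_deriv cs x \<in> carrier R" using c x' by auto
  have "v x * v (horner cs x) < 1" "v x * v (horner_deriv cs x) < 1"
    using IH x' cc mult_right_le_one_le[of "v (horner cs x)" "v x"] mult_right_le_one_le[of "v (horner_deriv cs x)" "v x"]
    by (auto simp: mult.commute)
  then show ?case
    using IH c cc x' v_add_le_max[of c "x \<otimes> horner cs x"] v_add_le_max[of "horner cs x" "x \<otimes> horner_deriv cs x"]
    by auto
qed

text \<open>The carrier of the value group, as a plain set of positive reals.\<close>

definition value_set :: "'a set \<Rightarrow> real set" where
  "value_set C = v ` (C - {\<zero>})"

lemma value_set_mono: "C \<subseteq> D \<Longrightarrow> value_set C \<subseteq> value_set D"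
  by (auto simp: value_set_def)

lemma value_set_subfield:
  assumes "subfield C R"
  shows "1 \<in> value_set C" "a \<in> value_set C \<Longrightarrow> b \<in> value_set C \<Longrightarrow> a * b \<in> value_set C"
    "a \<in> value_set C \<Longrightarrow> inverse a \<in> value_set C" "a \<in> value_set C \<Longrightarrow> 0 < a"
    "a \<in> value_set C \<Longrightarrow> a ^ n \<in> value_set C"
proof -
  note C' = subringE[OF subfieldE(1)[OF assms]]
  show one: "1 \<in> value_set C"
    unfolding value_set_def using C' by (intro image_eqI[of _ _ \<one>]) auto
  show mult: "a * b \<in> value_set C" if a: "a \<in> value_set C" and b: "b \<in> value_set C" for a b
  proof -
    obtain x where x: "x \<in> C" "x \<noteq> \<zero>" "a = v x" using a by (auto simp: value_set_def)
    obtain y where y: "y \<in> C" "y \<noteq> \<zero>" "b = v y" using b by (auto simp: value_set_def)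
    have "x \<in> carrier R" "y \<in> carrier R" using x y C'(1) by auto
    then show ?thesis unfolding value_set_def using x y C'(6) integral
      by (intro image_eqI[of _ _ "x \<otimes> y"]) auto
  qed
  show "inverse a \<in> value_set C" if a: "a \<in> value_set C"
  proof -
    obtain x where x: "x \<in> C" "x \<noteq> \<zero>" "a = v x" using a by (auto simp: value_set_def)
    moreover have "x \<in> carrier R" using x C'(1) by auto
    ultimately show ?thesis unfolding value_set_def using subfield_m_inv[OF assms, of x]
      by (intro image_eqI[of _ _ "inv x"]) auto
  qed
  show "0 < a" if "a \<in> value_set C" using that C' by (auto simp: value_set_def subset_iff)
  show "a ^ n \<in> value_set C" if "a \<in> value_set C" by (induction n) (auto simp: one mult that)
qed

end

context ultrametric_field begin

text \<open>If the values of \<open>1, p, ..., p ^ (n - 1)\<close> are in distinct classes modulo the value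
  group of \<open>C\<close>, no two nonzero terms of a polynomial of degree less than \<open>n\<close> have the
  same value at \<open>p\<close>, so its value is that of one of its terms.\<close>

lemma v_horner_dominant:
  assumes C: "subfield C R" and p: "p \<in> carrier R" "p \<noteq> \<zero>"
    and order: "\<And>i. 0 < i \<Longrightarrow> i < n \<Longrightarrow> v p ^ i \<notin> value_set C"
    and cs: "set cs \<subseteq> C" "length cs \<le> n"
  shows "set cs \<subseteq> {\<zero>} \<or> (\<exists>c\<in>value_set C. \<exists>i<length cs. v (horner cs p) = c * v p ^ i)"
  using cs
proof (induction cs rule: rev_induct)
  case Nil
  then show ?case by simp
next
  case (snoc t cs)
  have "t \<in> C" "set cs \<subseteq> C" using snoc by auto
  then have t: "t \<in> C" "t \<in> carrier R" "set cs \<subseteq> C" "set cs \<subseteq> carrier R"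
    using subfieldE(3)[OF C] by blast+
  have vp: "0 < v p" using p by simp
  define A where "A = horner cs p"
  define B where "B = t \<otimes> p [^] length cs"
  have AB: "A \<in> carrier R" "B \<in> carrier R" using t p by (auto simp: A_def B_def)
  have e: "horner (cs @ [t]) p = A \<oplus> B" using t p by (simp add: horner_snoc A_def B_def)
  have IH: "set cs \<subseteq> {\<zero>} \<or> (\<exists>c\<in>value_set C. \<exists>i<length cs. v A = c * v p ^ i)"
    using snoc t unfolding A_def by auto
  show ?case
  proof (cases "t = \<zero>")
    case True
    then have "A \<oplus> B = A" using AB p by (simp add: B_def)
    then show ?thesis using IH True unfolding e by (auto intro: less_SucI)
  next
    case False
    then have B: "v B = v t * v p ^ length cs" "v t \<in> value_set C"
      using t p by (auto simp: B_def value_set_def)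
    then have *: "\<exists>c\<in>value_set C. \<exists>i<length (cs @ [t]). v B = c * v p ^ i" by auto
    show ?thesis
    proof (cases "set cs \<subseteq> {\<zero>}")
      case True
      then have "A = \<zero>" unfolding A_def using p by (induction cs) auto
      then show ?thesis using * AB unfolding e by simp
    next
      case False
      then obtain c i where ci: "c \<in> value_set C" "i < length cs" "v A = c * v p ^ i" using IH by auto
      have "v A \<noteq> v B"
      proof
        assume "v A = v B"
        then have "c * v p ^ i = v t * (v p ^ i * v p ^ (length cs - i))"
          using ci B by (simp flip: power_add)
        then have "c = v t * v p ^ (length cs - i)" using vp by simp
        moreover have "0 < v t" using value_set_subfield(4)[OF C B(2)] .
        ultimately have "v p ^ (length cs - i) = inverse (v t) * c" by (simp add: field_simps)
        then have "v p ^ (length cs - i) \<in> value_set C"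
          using value_set_subfield[OF C] B(2) ci(1) by metis
        moreover have "0 < length cs - i" "length cs - i < n" using ci(2) snoc(3) by auto
        ultimately show False using order by blast
      qed
      then consider "v A < v B" | "v B < v A" by linarith
      then show ?thesis
      proof cases
        case 1
        then show ?thesis using v_add_eq_right[OF AB] * unfolding e by simp
      next
        case 2
        then have "v (A \<oplus> B) = v A" using v_add_eq_right[OF AB(2,1)] AB by (simp add: a_comm)
        then show ?thesis using ci unfolding e by (auto intro: less_SucI)
      qed
    qed
  qed
qed

text \<open>Modulo \<open>X ^ n - p ^ n\<close> every polynomial over \<open>C\<close> reduces to one of
  degree less than \<open>n\<close>.\<close>

lemma value_set_radical_extension:
  assumes C: "subfield C R" and p: "p \<in> carrier R" "p \<noteq> \<zero>" and n: "0 < n" "p [^] n \<in> C"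
    and order: "\<And>i. 0 < i \<Longrightarrow> i < n \<Longrightarrow> v p ^ i \<notin> value_set C"
    and a: "a \<in> value_set (simple_extension C p)"
  shows "\<exists>c\<in>value_set C. \<exists>i. a = c * v p ^ i"
proof -
  note C' = subringE[OF subfieldE(1)[OF C]]
  define hs where "hs = \<ominus> (p [^] n) # replicate (n - 1) \<zero>"
  have hs: "set hs \<subseteq> C" "length hs = n" using n C'(2,5) by (auto simp: hs_def)
  have z: "horner cs p = \<zero>" if "set cs \<subseteq> {\<zero>}" for cs using that p by (induction cs) auto
  have "horner (hs @ [\<one>]) p = \<zero>"
  proof -
    have "horner (hs @ [\<one>]) p = horner hs p \<oplus> p [^] n"
      using horner_snoc[OF order_trans[OF hs(1) C'(1)] one_closed p(1)] hs(2) p by simp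
    also have "horner (replicate (n - 1) \<zero>) p = \<zero>" by (rule z) auto
    then have "horner hs p = \<ominus> (p [^] n)" using p by (simp add: hs_def)
    finally show ?thesis using p by (simp add: l_neg)
  qed
  moreover obtain z where z': "z \<in> simple_extension C p" "z \<noteq> \<zero>" "a = v z"
    using a by (auto simp: value_set_def)
  ultimately obtain cs where cs: "set cs \<subseteq> C" "length cs = n" "horner cs p = z"
    using simple_extension_eq_horner[OF subfieldE(1)[OF C] hs(1) p(1)] hs(2) by auto
  have "\<not> set cs \<subseteq> {\<zero>}" using z cs(3) z'(2) by blast
  then show ?thesis using v_horner_dominant[OF C p order cs(1)] cs z'(3) by auto
qed

end

section \<open>Finite extensions of complete fields\<close>

locale complete_extension = ultrametric_field +
  fixes K
  assumes K: "subfield K R" and finite_dim: "finite_dimension K (carrier R)"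
    and complete_K: "complete_on K"
begin

text \<open>The vector \<open>u\<close> has positive distance \<open>d\<close> from the complete, hence
  closed, subspace \<open>E\<close>. So the coefficient of \<open>u\<close> in an element of
  \<open>K u + E\<close> is bounded by a multiple of the value of that element, and both components of a
  Cauchy sequence are Cauchy.\<close>

lemma complete_on_line_extension:
  assumes E: "subalgebra K E R" "complete_on E" and u: "u \<in> carrier R" "u \<notin> E"
  shows "complete_on (line_extension K u E)"
proof -
  note K' = subringE[OF subfieldE(1)[OF K]]
  interpret E: subalgebra K E R by fact
  have Ec: "w \<in> carrier R" if "w \<in> E" for w using that subalgebra_in_carrier[OF E(1)] by auto
  have Kc: "k \<in> carrier R" if "k \<in> K" for k using that K' by auto
  have E_neg: "\<ominus> w \<in> E" if "w \<in> E" for w using E.m_inv_closed[OF that] by (simp add: a_inv_def)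
  have E_zero: "\<zero> \<in> E" using E.one_closed by simp
  have "\<exists>d>0. \<forall>w\<in>E. d \<le> v (w \<ominus> u)"
  proof (rule ccontr)
    assume "\<not> ?thesis"
    then have "\<forall>n. \<exists>w\<in>E. v (w \<ominus> u) < inverse (real (Suc n))"
      by (metis inverse_positive_iff_positive not_le of_nat_0_less_iff zero_less_Suc)
    then obtain s where s: "\<And>n. s n \<in> E" "\<And>n. v (s n \<ominus> u) < inverse (real (Suc n))" by metis
    then have rs: "range s \<subseteq> E" "range s \<subseteq> carrier R" using Ec by auto
    have lim: "(\<lambda>n. v (s n \<ominus> u)) \<longlonglongrightarrow> 0"
    proof (rule tendsto_sandwich[OF _ _ tendsto_const LIMSEQ_inverse_real_of_nat])
      show "\<forall>\<^sub>F n in sequentially. 0 \<le> v (s n \<ominus> u)" using s Ec u by simp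
      show "\<forall>\<^sub>F n in sequentially. v (s n \<ominus> u) \<le> inverse (real (Suc n))" 
        using s(2) by (simp add: less_imp_le)
    qed
    obtain l where "l \<in> E" "(\<lambda>n. v (s n \<ominus> l)) \<longlonglongrightarrow> 0"
      using E(2) rs convergent_imp_cauchy_seq[OF rs(2) u(1) lim] unfolding complete_on_def by blast
    then show False using limit_unique[OF rs(2) u(1) _ lim] Ec u by auto
  qed
  then obtain d where d: "d > 0" "\<And>w. w \<in> E \<Longrightarrow> d \<le> v (w \<ominus> u)" by auto
  have coeff: "v k * d \<le> v (k \<otimes> u \<oplus> w)" if k: "k \<in> K" and w: "w \<in> E" for k w
  proof (cases "k = \<zero>")
    case True
    then show ?thesis using u w Ec by simp
  next
    case False
    have i: "inv k \<in> K" using subfield_m_inv[OF K] k False by auto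
    have "\<ominus> (inv k \<otimes> w) \<in> E" using E_neg E.smult_closed i w by auto
    then have "d \<le> v (\<ominus> (inv k \<otimes> w) \<ominus> u)" by (rule d)
    then have "v k * d \<le> v k * v (\<ominus> (inv k \<otimes> w) \<ominus> u)" using k Kc by (intro mult_left_mono) auto
    also have "\<dots> = v (k \<otimes> (\<ominus> (inv k \<otimes> w) \<ominus> u))" using k i w u Kc Ec by simp
    also have "k \<otimes> (\<ominus> (inv k \<otimes> w) \<ominus> u) = \<ominus> ((k \<otimes> inv k) \<otimes> w) \<oplus> \<ominus> (k \<otimes> u)"
      using Kc[OF k] Kc[OF i] Ec[OF w] u(1) by algebra
    also have "\<dots> = \<ominus> (k \<otimes> u \<oplus> w)"
      using Kc[OF k] Ec[OF w] u(1) False by (simp add: minus_add a_comm)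
    finally show ?thesis using Kc[OF k] Ec[OF w] u(1) by simp
  qed
  show ?thesis
    unfolding complete_on_def
  proof (intro allI impI)
    fix s assume s: "range s \<subseteq> line_extension K u E \<and> cauchy_seq s"
    then have "\<forall>n. \<exists>k w. k \<in> K \<and> w \<in> E \<and> s n = k \<otimes> u \<oplus> w"
      by (auto simp: line_extension_mem_iff subset_iff)
    then obtain k w where kw: "\<And>n. k n \<in> K" "\<And>n. w n \<in> E" "\<And>n. s n = k n \<otimes> u \<oplus> w n" by metis
    have kc: "k n \<in> carrier R" and wc: "w n \<in> carrier R" for n using kw Kc Ec by auto
    have diff: "s m \<ominus> s n = (k m \<ominus> k n) \<otimes> u \<oplus> (w m \<ominus> w n)" for m n
      using kc[of m] kc[of n] wc[of m] wc[of n] u(1) unfolding kw(3) by algebra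
    have K_diff: "k m \<ominus> k n \<in> K" and E_diff: "w m \<ominus> w n \<in> E" for m n
      using kw K' E_neg E.m_closed by (auto simp: a_minus_def)
    have k_le: "v (k m \<ominus> k n) * d \<le> v (s m \<ominus> s n)" for m n
      unfolding diff by (intro coeff K_diff E_diff)
    have w_le: "v (w m \<ominus> w n) \<le> max 1 (v u / d) * v (s m \<ominus> s n)" for m n
    proof -
      have sc: "s m \<ominus> s n \<in> carrier R" using kc wc u by (simp add: kw(3))
      have "w m \<ominus> w n = (s m \<ominus> s n) \<ominus> (k m \<ominus> k n) \<otimes> u"
        using kc[of m] kc[of n] wc[of m] wc[of n] u(1) unfolding diff by algebra
      then have "v (w m \<ominus> w n) \<le> max (v (s m \<ominus> s n)) (v (k m \<ominus> k n) * v u)"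
        using v_minus_le_max[OF sc, of "(k m \<ominus> k n) \<otimes> u"] kc u by simp
      also have "v (k m \<ominus> k n) * v u \<le> v u / d * v (s m \<ominus> s n)"
        using mult_right_mono[OF k_le[of m n], of "v u / d"] d u by (simp add: mult.commute)
      also have "max (v (s m \<ominus> s n)) (v u / d * v (s m \<ominus> s n)) \<le> max 1 (v u / d) * v (s m \<ominus> s n)"
        using mult_right_mono[of 1 "max 1 (v u / d)" "v (s m \<ominus> s n)"] 
          mult_right_mono[of "v u / d" "max 1 (v u / d)" "v (s m \<ominus> s n)"] sc by simp
      finally show ?thesis by simp
    qed
    have cs: "\<exists>n0. \<forall>m\<ge>n0. \<forall>n\<ge>n0. v (s m \<ominus> s n) < e" if "e > 0" for e
      using s that by (auto simp: cauchy_seq_def)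
    have "cauchy_seq k"
      unfolding cauchy_seq_def
    proof (intro allI impI)
      fix e :: real assume "e > 0"
      then obtain n0 where n0: "\<And>m n. m \<ge> n0 \<Longrightarrow> n \<ge> n0 \<Longrightarrow> v (s m \<ominus> s n) < e * d" 
        using cs[of "e * d"] d by auto
      have "v (k m \<ominus> k n) < e" if "m \<ge> n0" "n \<ge> n0" for m n
        using le_less_trans[OF k_le n0[OF that]] d(1) by simp
      then show "\<exists>n0. \<forall>m\<ge>n0. \<forall>n\<ge>n0. v (k m \<ominus> k n) < e" by blast
    qed
    then obtain l where l: "l \<in> K" "(\<lambda>n. v (k n \<ominus> l)) \<longlonglongrightarrow> 0"
      using complete_K kw unfolding complete_on_def by blast
    have "cauchy_seq w"
      unfolding cauchy_seq_def
    proof (intro allI impI)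
      let ?c = "max 1 (v u / d)"
      fix e :: real assume "e > 0"
      then obtain n0 where n0: "\<And>m n. m \<ge> n0 \<Longrightarrow> n \<ge> n0 \<Longrightarrow> v (s m \<ominus> s n) < e / ?c" 
        using cs[of "e / ?c"] by auto
      have "v (w m \<ominus> w n) < e" if "m \<ge> n0" "n \<ge> n0" for m n
      proof -
        have "v (w m \<ominus> w n) \<le> ?c * v (s m \<ominus> s n)" by (rule w_le)
        also have "\<dots> < ?c * (e / ?c)" by (intro mult_strict_left_mono n0 that) auto
        finally show ?thesis by simp
      qed
      then show "\<exists>n0. \<forall>m\<ge>n0. \<forall>n\<ge>n0. v (w m \<ominus> w n) < e" by blast
    qed
    then obtain z where z: "z \<in> E" "(\<lambda>n. v (w n \<ominus> z)) \<longlonglongrightarrow> 0"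
      using E(2) kw unfolding complete_on_def by blast
    have lz: "l \<in> carrier R" "z \<in> carrier R" using l z Kc Ec by auto
    have "(\<lambda>n. max (v (k n \<ominus> l) * v u) (v (w n \<ominus> z))) \<longlonglongrightarrow> max (0 * v u) 0"
      by (intro tendsto_intros l z)
    then have bound: "(\<lambda>n. max (v (k n \<ominus> l) * v u) (v (w n \<ominus> z))) \<longlonglongrightarrow> 0" by simp
    have "v (s n \<ominus> (l \<otimes> u \<oplus> z)) \<le> max (v (k n \<ominus> l) * v u) (v (w n \<ominus> z))" for n
    proof -
      have "s n \<ominus> (l \<otimes> u \<oplus> z) = (k n \<ominus> l) \<otimes> u \<oplus> (w n \<ominus> z)"
        using kc[of n] wc[of n] lz u(1) unfolding kw(3) by algebra
      then show ?thesis using v_add_le_max[of "(k n \<ominus> l) \<otimes> u" "w n \<ominus> z"] kc wc lz u by simp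
    qed
    then have "(\<lambda>n. v (s n \<ominus> (l \<otimes> u \<oplus> z))) \<longlonglongrightarrow> 0"
      using kc wc lz u
      by (intro tendsto_sandwich[OF _ _ tendsto_const bound] always_eventually allI) (auto simp: kw(3))
    moreover have "l \<otimes> u \<oplus> z \<in> line_extension K u E" 
      using l z by (auto simp: line_extension_mem_iff)
    ultimately show "\<exists>l\<in>line_extension K u E. (\<lambda>n. v (s n \<ominus> l)) \<longlonglongrightarrow> 0" by blast
  qed
qed

lemma complete_on_dimension: "dimension n K E \<Longrightarrow> complete_on E"
proof (induction n arbitrary: E)
  case 0
  then have "E = {\<zero>}" by (rule dimension_zero[OF K])
  have "(\<lambda>n. v (s n \<ominus> \<zero>)) \<longlonglongrightarrow> 0" if "range s \<subseteq> E" for s :: "nat \<Rightarrow> 'a"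
  proof -
    have "s n = \<zero>" for n using that \<open>E = {\<zero>}\<close> by auto
    then show ?thesis by simp
  qed
  then show ?case unfolding complete_on_def using \<open>E = {\<zero>}\<close> by auto
next
  case (Suc n)
  then obtain u E' where *: "u \<in> carrier R" "dimension n K E'" "u \<notin> E'" "E = line_extension K u E'"
    using dimension_backwards[OF K] by blast
  then have "subalgebra K E' R"
    using finite_dimension_imp_subalgebra[OF K] finite_dimensionI by blast
  then show ?case using complete_on_line_extension Suc * by auto
qed

abbreviation intermediate :: "'a set \<Rightarrow> bool" where
  "intermediate \<equiv> intermediate_field R K"

lemma intermediateD:
  assumes "intermediate C"
  shows "subfield C R" "K \<subseteq> C" "subring C R" "C \<subseteq> carrier R"
  using assms subfieldE by (auto simp: intermediate_field_def)

lemma finite_dimension_intermediate: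
  assumes "intermediate C"
  shows "finite_dimension K C"
proof -
  have "subalgebra K C R"
    using subringE[OF intermediateD(3)[OF assms]] intermediateD(2)[OF assms]
      subring.axioms(1)[OF intermediateD(3)[OF assms]]
    by (auto simp: subalgebra_def subalgebra_axioms_def)
  then show ?thesis 
    using subalbegra_incl_imp_finite_dimension[OF K finite_dim] intermediateD(4)[OF assms] by blast
qed

lemma complete_on_intermediate: "intermediate C \<Longrightarrow> complete_on C"
  using finite_dimension_intermediate complete_on_dimension by (auto simp: finite_dimension_def)

lemma intermediate_carrier: "intermediate (carrier R)"
  using K carrier_is_subfield by (auto simp: intermediate_field_def dest: subfieldE(3))

lemma intermediate_inter:
  assumes "intermediate C" "intermediate D"
  shows "intermediate (C \<inter> D)"
proof -
  have "subfield (C \<inter> D) R"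
    using subring_inter intermediateD[OF assms(1)] intermediateD[OF assms(2)]
      subfield_m_inv[OF intermediateD(1)[OF assms(1)]] subfield_m_inv[OF intermediateD(1)[OF assms(2)]]
    by (intro subfieldI') auto
  then show ?thesis using assms by (auto simp: intermediate_field_def)
qed

lemma intermediate_simple_extension:
  assumes "intermediate C" "x \<in> carrier R"
  shows "intermediate (simple_extension C x)" "C \<subseteq> simple_extension C x" "x \<in> simple_extension C x"
proof -
  have "(algebraic over K) x"
    using finite_dimension_imp_algebraic[OF K carrier_is_subring finite_dim assms(2)] .
  then have "(algebraic over C) x" using algebraic_mono intermediateD(2)[OF assms(1)] by blast
  then have "subfield (simple_extension C x) R"
    using simple_extension_is_subfield intermediateD[OF assms(1)] assms(2) by blast
  moreover show "C \<subseteq> simple_extension C x"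
    using simple_extension_incl intermediateD[OF assms(1)] assms(2) by blast
  ultimately show "intermediate (simple_extension C x)"
    using intermediateD[OF assms(1)] by (auto simp: intermediate_field_def)
  show "x \<in> simple_extension C x"
    using simple_extension_mem intermediateD[OF assms(1)] assms(2) by blast
qed

lemma simple_extension_subset:
  "intermediate D \<Longrightarrow> C \<subseteq> D \<Longrightarrow> x \<in> D \<Longrightarrow> simple_extension C x \<subseteq> D"
  using simple_extension_subring_incl intermediateD by blast

end

context ultrametric_field begin

lemma complete_on_if_mcomplete:
  assumes K: "subring K R" and w: "\<And>x. x \<in> K \<Longrightarrow> v x = w x"
    and complete: "Metric_space.mcomplete (carrier (R\<lparr>carrier := K\<rparr>)) (abs_dist (R\<lparr>carrier := K\<rparr>) w)"
  shows "complete_on K"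
proof -
  note K' = subringE[OF K]
  define d where "d = abs_dist (R\<lparr>carrier := K\<rparr>) w"
  interpret k: ring "R\<lparr>carrier := K\<rparr>" by (rule subring_is_ring[OF K])
  have Kc: "x \<in> carrier R" if "x \<in> K" for x using K'(1) that by blast
  have neg: "\<ominus>\<^bsub>R\<lparr>carrier := K\<rparr>\<^esub> x = \<ominus> x" if "x \<in> K" for x
    using that K'(5)[OF that] Kc[OF that] k.minus_equality[of "\<ominus> x" x] by (simp add: l_neg)
  have minus_K: "x \<ominus> y \<in> K" if "x \<in> K" "y \<in> K" for x y
    unfolding a_minus_def using that by (intro K'(7) K'(5))
  have d: "d x y = v (x \<ominus> y)" if "x \<in> K" "y \<in> K" for x y
    using that minus_K[OF that] neg[of y] w[of "x \<ominus> y"] by (simp add: d_def abs_dist_def a_minus_def)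
  have d0: "d x y = 0" if "\<not> (x \<in> K \<and> y \<in> K)" for x y
    using that by (auto simp: d_def abs_dist_def)
  interpret M: Metric_space K d
  proof
    show "0 \<le> d x y" for x y using d[of x y] d0[of x y] Kc by fastforce
    show "d x y = d y x" for x y
      using d[of x y] d[of y x] d0[of x y] d0[of y x] v_minus_commute[of x y] Kc by metis
    show "d x y = 0 \<longleftrightarrow> x = y" if "x \<in> K" "y \<in> K" for x y
      using d[OF that] Kc[OF that(1)] Kc[OF that(2)] by simp
    show "d x z \<le> d x y + d y z" if xyz: "x \<in> K" "y \<in> K" "z \<in> K" for x y z
    proof -
      have c: "x \<in> carrier R" "y \<in> carrier R" "z \<in> carrier R" using xyz Kc by auto
      have "v (x \<ominus> z) \<le> max (v (x \<ominus> y)) (v (y \<ominus> z))" using v_triangle[OF c] .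
      also have "\<dots> \<le> v (x \<ominus> y) + v (y \<ominus> z)" using c by simp
      finally show ?thesis using xyz by (simp add: d)
    qed
  qed
  have mc: "M.mcomplete" using complete by (simp add: d_def)
  show ?thesis
    unfolding complete_on_def
  proof (intro allI impI)
    fix s assume s: "range s \<subseteq> K \<and> cauchy_seq s"
    then have sK: "s n \<in> K" for n by auto
    have "M.MCauchy s"
      using s sK unfolding M.MCauchy_def cauchy_seq_def by (auto simp: d)
    then obtain l where l: "limitin M.mtopology s l sequentially"
      using mc unfolding M.mcomplete_def by blast
    then have "l \<in> K" "(\<lambda>n. d (s n) l) \<longlonglongrightarrow> 0" unfolding M.limitin_metric_dist_null by auto
    then show "\<exists>l\<in>K. (\<lambda>n. v (s n \<ominus> l)) \<longlonglongrightarrow> 0" using d sK by auto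
  qed
qed

end

section \<open>Unramified simple extensions\<close>

context complete_extension begin

text \<open>A root of a monic polynomial over the valuation ring of \<open>C\<close> at which the derivative is
  a unit. The residue of such an element is a simple root of the reduced polynomial, hence separable over the
  residue field of \<open>C\<close>; adjoining it yields an unramified extension.\<close>

definition residually_simple_root :: "'a set \<Rightarrow> 'a \<Rightarrow> bool" where
  "residually_simple_root C w \<longleftrightarrow> w \<in> valuation_ring R v \<and>
    (\<exists>cs. set cs \<subseteq> C \<inter> valuation_ring R v \<and> horner (cs @ [\<one>]) w = \<zero> \<and> v (horner_deriv (cs @ [\<one>]) w) = 1)"

lemma residually_simple_root_mono:
  "residually_simple_root C w \<Longrightarrow> C \<subseteq> D \<Longrightarrow> residually_simple_root D w"
  unfolding residually_simple_root_def by blast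

lemma one_in_valuation_ring: "\<one> \<in> valuation_ring R v"
  using subringE(3)[OF subring_valuation_ring] .

text \<open>The monic polynomial \<open>hs @ [\<one>]\<close> lifts the minimal polynomial of the residue of
  \<open>w\<close>. It is found without passing to the residue field, as a monic polynomial of least degree with
  small value at \<open>w\<close>: a polynomial of smaller degree that is small at \<open>w\<close> and has a
  unit coefficient would yield, after dropping its small leading coefficients and dividing by the first unit, a
  monic one contradicting minimality.\<close>

lemma exists_residual_minimal_polynomial:
  assumes C: "subfield C R" and w: "w \<in> valuation_ring R v"
    and cs: "set cs \<subseteq> C \<inter> valuation_ring R v" "v (horner (cs @ [\<one>]) w) < 1"
  shows "\<exists>hs. set hs \<subseteq> C \<inter> valuation_ring R v \<and> v (horner (hs @ [\<one>]) w) < 1 \<and>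
    (\<forall>us. set us \<subseteq> C \<inter> valuation_ring R v \<and> length us \<le> length hs \<and> v (horner us w) < 1 \<longrightarrow>
      (\<forall>u\<in>set us. v u < 1))"
proof -
  define S where "S = C \<inter> valuation_ring R v"
  have S: "subring S R" using subring_inter[OF subfieldE(1)[OF C] subring_valuation_ring] by (simp add: S_def)
  note S' = subringE[OF S]
  have car: "y \<in> carrier R" "v y \<le> 1" "y \<in> C" if "y \<in> S" for y
    using that by (auto simp: S_def mem_valuation_ring)
  have wc: "w \<in> carrier R" "v w \<le> 1" using w by (auto simp: mem_valuation_ring)
  define P where "P = (\<lambda>r. \<exists>hs. set hs \<subseteq> S \<and> length hs = r \<and> v (horner (hs @ [\<one>]) w) < 1)"
  have "P (length cs)" using cs by (auto simp: P_def S_def)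
  then have "P (LEAST r. P r)" by (rule LeastI)
  then obtain hs where hs: "set hs \<subseteq> S" "length hs = (LEAST r. P r)" "v (horner (hs @ [\<one>]) w) < 1"
    by (auto simp: P_def)
  have min: "1 \<le> v (horner (us @ [\<one>]) w)" if us: "set us \<subseteq> S" "length us < length hs" for us
  proof (rule ccontr)
    assume "\<not> ?thesis"
    then have "P (length us)" using us by (auto simp: P_def)
    then have "length hs \<le> length us" unfolding hs(2) by (rule Least_le)
    then show False using us by simp
  qed
  have "\<forall>u\<in>set us. v u < 1" if "set us \<subseteq> S" "length us \<le> length hs" "v (horner us w) < 1" for us
    using that
  proof (induction us rule: rev_induct)
    case Nil
    show ?case by simp
  next
    case (snoc t us)
    have t: "t \<in> S" "t \<in> carrier R" "v t \<le> 1" and us: "set us \<subseteq> S" "set us \<subseteq> carrier R" 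
      using snoc car by auto
    have hu: "horner us w \<in> carrier R" "w [^] length us \<in> carrier R" using us wc by auto
    have "v t < 1"
    proof (rule ccontr)
      assume "\<not> v t < 1"
      then have vt: "v t = 1" using t by simp
      then have t0: "t \<noteq> \<zero>" by auto
      have i: "inv t \<in> S" "inv t \<in> carrier R"
        using subfield_m_inv(1)[OF C, of t] car(3)[OF t(1)] t t0 vt by (auto simp: S_def mem_valuation_ring)
      have "set (map ((\<otimes>) (inv t)) us) \<subseteq> S" using us(1) i S'(6) by auto
      then have "1 \<le> v (horner (map ((\<otimes>) (inv t)) us @ [\<one>]) w)" using snoc(3) by (intro min) auto
      also have "map ((\<otimes>) (inv t)) us @ [\<one>] = map ((\<otimes>) (inv t)) (us @ [t])" using t t0 by simp
      also have "v (horner \<dots> w) = v (horner (us @ [t]) w)"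
        using horner_scale[of "us @ [t]" "inv t" w] us t i wc t0 vt by simp
      finally show False using snoc by simp
    qed
    moreover have "v (horner us w) < 1"
    proof -
      have "horner us w = horner (us @ [t]) w \<ominus> t \<otimes> w [^] length us"
        unfolding horner_snoc[OF us(2) t(2) wc(1)] using hu t by algebra
      then have "v (horner us w) \<le> max (v (horner (us @ [t]) w)) (v (t \<otimes> w [^] length us))"
        using v_minus_le_max[of "horner (us @ [t]) w" "t \<otimes> w [^] length us"] us t wc by simp
      moreover have "v (t \<otimes> w [^] length us) \<le> v t"
        using t wc by (simp add: mult_left_le power_le_one)
      ultimately show ?thesis using \<open>v t < 1\<close> snoc(4) by simp
    qed
    ultimately show ?case using snoc.IH us snoc(3) by auto
  qed
  then show ?thesis using hs unfolding S_def by blast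
qed

text \<open>Extensions generated by residually simple roots are unramified. The lift \<open>h\<close> of the
  residual minimal polynomial of \<open>w\<close> need not vanish at \<open>w\<close>, but it has a root
  \<open>w'\<close> close to \<open>w\<close>. The powers of \<open>w'\<close> below the degree of
  \<open>h\<close> span \<open>C(w')\<close> and have linearly independent residues, so every value in
  \<open>C(w')\<close> is the value of a coefficient. Finally \<open>w\<close> itself lies in
  \<open>C(w')\<close>: the polynomial of which \<open>w\<close> is a simple root has a root in
  \<open>C(w')\<close> close to \<open>w'\<close>, and that root is \<open>w\<close>. Working with root lifting
  in this way replaces the lifting of coprime factorisations.\<close>

lemma value_set_simple_extension:
  assumes C: "intermediate C" and w: "residually_simple_root C w"
  shows "value_set (simple_extension C w) = value_set C"
proof -
  note Cs = intermediateD[OF C]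
  define S where "S = C \<inter> valuation_ring R v"
  have S: "subring S R" using subring_inter[OF Cs(3) subring_valuation_ring] by (simp add: S_def)
  note S' = subringE[OF S]
  have car: "y \<in> carrier R" "v y \<le> 1" "y \<in> C" if "y \<in> S" for y
    using that by (auto simp: S_def mem_valuation_ring)
  obtain fs where wO: "w \<in> valuation_ring R v" and fs: "set fs \<subseteq> S" "horner (fs @ [\<one>]) w = \<zero>"
    "v (horner_deriv (fs @ [\<one>]) w) = 1" using w by (auto simp: residually_simple_root_def S_def)
  have wc: "w \<in> carrier R" "v w \<le> 1" using wO by (auto simp: mem_valuation_ring)
  have "v (horner (fs @ [\<one>]) w) < 1" using fs(2) by simp
  then obtain hs where hs: "set hs \<subseteq> S" "v (horner (hs @ [\<one>]) w) < 1"
    and small: "\<And>us. set us \<subseteq> S \<Longrightarrow> length us \<le> length hs \<Longrightarrow> v (horner us w) < 1 \<Longrightarrow> \<forall>u\<in>set us. v u < 1"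
    using exists_residual_minimal_polynomial[OF Cs(1) wO, of fs] fs(1) unfolding S_def by blast
  have SO: "set us \<subseteq> valuation_ring R v" "set us \<subseteq> carrier R" "set us \<subseteq> C" if "set us \<subseteq> S" for us
    using that car(1) unfolding S_def by blast+
  have h1: "set (hs @ [\<one>]) \<subseteq> S" and f1: "set (fs @ [\<one>]) \<subseteq> S" using hs fs S' by auto
  \<comment> \<open>Dividing \<open>f\<close> by \<open>h\<close> leaves a remainder with small coefficients, so \<open>f'(w)\<close> and \<open>h'(w) q(w)\<close> agree up to
    small terms.\<close>
  have h_simple: "v (horner_deriv (hs @ [\<one>]) w) = 1"
  proof -
    obtain qs rs where q: "set qs \<subseteq> S" and r: "set rs \<subseteq> S" "length rs = length hs"
      and e: "horner (fs @ [\<one>]) w = horner (hs @ [\<one>]) w \<otimes> horner qs w \<oplus> horner rs w"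
      and d: "horner_deriv (fs @ [\<one>]) w = horner_deriv (hs @ [\<one>]) w \<otimes> horner qs w
        \<oplus> horner (hs @ [\<one>]) w \<otimes> horner_deriv qs w \<oplus> horner_deriv rs w"
      using horner_division[OF S hs(1) f1] wc by auto
    define H where "H = horner (hs @ [\<one>]) w"
    define H' where "H' = horner_deriv (hs @ [\<one>]) w"
    define Q where "Q = horner qs w"
    define Q' where "Q' = horner_deriv qs w"
    define T where "T = horner rs w"
    define T' where "T' = horner_deriv rs w"
    note defs = H_def[symmetric] H'_def[symmetric] Q_def[symmetric] Q'_def[symmetric] T_def[symmetric] T'_def[symmetric]
    have cc: "H \<in> carrier R" "H' \<in> carrier R" "Q \<in> carrier R" "Q' \<in> carrier R" "T \<in> carrier R" "T' \<in> carrier R"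
      unfolding H_def H'_def Q_def Q'_def T_def T'_def
      by (intro horner_closed horner_deriv_closed SO(2) h1 q r(1) wc)+
    have le: "v H < 1" "v H' \<le> 1" "v Q \<le> 1" "v Q' \<le> 1"
      unfolding H_def H'_def Q_def Q'_def
      using hs(2) v_horner_le_1[OF SO(1)[OF h1] wO] v_horner_le_1[OF SO(1)[OF q] wO] by auto
    have HQ: "v (H \<otimes> Q) < 1" "v (H \<otimes> Q') < 1"
      using le cc mult_left_le[of "v Q" "v H"] mult_left_le[of "v Q'" "v H"] by auto
    have "H \<otimes> Q \<oplus> T = \<zero>" using e fs(2) unfolding defs by simp
    then have "T = \<ominus> (H \<otimes> Q)" using cc by (metis add.inv_equality a_comm m_closed)
    then have "v T < 1" using HQ cc by simp
    then have "\<forall>u\<in>set rs. v u < 1" using small r unfolding T_def by simp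
    then have T': "v T' < 1" unfolding T'_def using v_horner_deriv_lt_1[of rs w] wO SO(2)[OF r(1)] by auto
    have "v (H \<otimes> Q' \<oplus> T') < 1" using v_add_le_max[of "H \<otimes> Q'" T'] HQ T' cc by auto
    moreover have "v (H' \<otimes> Q \<oplus> (H \<otimes> Q' \<oplus> T')) = 1"
    proof -
      have "H' \<otimes> Q \<oplus> (H \<otimes> Q' \<oplus> T') = H' \<otimes> Q \<oplus> H \<otimes> Q' \<oplus> T'" using cc by algebra
      then show ?thesis using d fs(3) unfolding defs by simp
    qed
    moreover have "v (H' \<otimes> Q \<oplus> (H \<otimes> Q' \<oplus> T')) \<le> max (v (H' \<otimes> Q)) (v (H \<otimes> Q' \<oplus> T'))"
      using cc by (intro v_add_le_max) auto
    ultimately have "1 \<le> v H' * v Q" using cc by (simp add: le_max_iff_disj)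
    also have "\<dots> \<le> v H'" using le cc by (simp add: mult_left_le)
    finally show ?thesis using le by (simp add: H'_def)
  qed
  obtain w' where w': "w' \<in> valuation_ring R v" "horner (hs @ [\<one>]) w' = \<zero>" "v (w' \<ominus> w) < 1"
  proof -
    have "\<exists>y\<in>carrier R \<inter> valuation_ring R v. horner (hs @ [\<one>]) y = \<zero> \<and> v (y \<ominus> w) < 1"
      using complete_on_intermediate[OF intermediate_carrier] SO[OF h1] wO wc hs(2) h_simple
      by (intro hensel carrier_is_subfield) auto
    then show ?thesis using that by auto
  qed
  have w'c: "w' \<in> carrier R" using w' by (auto simp: mem_valuation_ring)
  define D where "D = simple_extension C w'"
  have D: "intermediate D" "C \<subseteq> D" "w' \<in> D"
    unfolding D_def using intermediate_simple_extension[OF C w'c] by auto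
  have D_values: "value_set D \<subseteq> value_set C"
  proof
    fix a assume "a \<in> value_set D"
    then obtain z where z: "z \<in> D" "z \<noteq> \<zero>" "a = v z" by (auto simp: value_set_def)
    obtain cs where cs: "set cs \<subseteq> C" "length cs = length hs" "horner cs w' = z"
      using simple_extension_eq_horner[OF Cs(3) SO(3)[OF hs(1)] w'c w'(2)] z(1) by (auto simp: D_def)
    have csc: "set cs \<subseteq> carrier R" using cs(1) Cs(4) by blast
    have ne: "cs \<noteq> []" using cs z by auto
    \<comment> \<open>Divide by a coefficient of largest value: the new coefficients are integral and one of them is 1, so
      the value at \<open>w\<close>, and hence at \<open>w'\<close>, is 1.\<close>
    define m where "m = Max (v ` set cs)"
    have "m \<in> v ` set cs" unfolding m_def using ne by (intro Max_in) auto
    then obtain c where c: "c \<in> set cs" "v c = m" by auto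
    have max: "v u \<le> v c" if "u \<in> set cs" for u unfolding c(2) m_def using that by auto
    have cC: "c \<in> C" "c \<in> carrier R" using c cs csc by auto
    have c0: "c \<noteq> \<zero>"
    proof
      assume c0: "c = \<zero>"
      have "set cs \<subseteq> {\<zero>}"
      proof
        fix u assume u: "u \<in> set cs"
        then have "u \<in> carrier R" "v u \<le> 0" using max[OF u] csc c0 by auto
        then show "u \<in> {\<zero>}" using v_nonneg[of u] v_eq_0_iff[of u] by (metis antisym singletonI)
      qed
      then have "horner cs w' = \<zero>" using w'c by (induction cs) auto
      then show False using cs z by simp
    qed
    define us where "us = map ((\<otimes>) (inv c)) cs"
    have i: "inv c \<in> C" "inv c \<in> carrier R" using subfield_m_inv(1)[OF Cs(1), of c] cC c0 by auto
    have us: "set us \<subseteq> S"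
    proof
      fix x assume "x \<in> set us"
      then obtain u where u: "u \<in> set cs" "x = inv c \<otimes> u" by (auto simp: us_def)
      have "u \<in> C" "u \<in> carrier R" using u cs csc by auto
      moreover have "v x \<le> 1"
        using max[OF u(1)] u i cC c0 calculation by (simp add: field_simps)
      ultimately show "x \<in> S" using u i subringE(6)[OF Cs(3)] by (auto simp: S_def mem_valuation_ring)
    qed
    have uw: "horner us w \<in> carrier R" "horner us w' \<in> carrier R" using SO(2)[OF us] wc w'c by auto
    have "\<one> \<in> set us" using c cC c0 unfolding us_def by (auto intro!: image_eqI[of _ _ c])
    moreover have "length us \<le> length hs" using cs(2) by (simp add: us_def)
    ultimately have "\<not> v (horner us w) < 1" using small[OF us] by force
    moreover have "v (horner us w) \<le> 1" using v_horner_le_1(1)[OF SO(1)[OF us] wO] .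
    ultimately have "v (horner us w) = 1" by simp
    moreover have "v (horner us w' \<ominus> horner us w) < 1"
      using v_horner_diff_le(1)[OF SO(1)[OF us] wO w'(1)] w'(3) by simp
    ultimately have "v (horner us w') = 1" using v_eq_if_close[OF uw(2,1)] by simp
    then have "inverse (v c) * v z = 1"
      using horner_scale[OF csc i(2) w'c] cC c0 i z D intermediateD(4)[OF D(1)] by (auto simp: us_def cs(3))
    then have "v z = v c" using c0 cC by (simp add: field_simps)
    then show "a \<in> value_set C" using z c0 cC by (auto simp: value_set_def)
  qed
  have "w \<in> D"
  proof -
    have 1: "v (horner (fs @ [\<one>]) w' \<ominus> horner (fs @ [\<one>]) w) < 1"
      "v (horner_deriv (fs @ [\<one>]) w' \<ominus> horner_deriv (fs @ [\<one>]) w) < 1"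
      using v_horner_diff_le[OF SO(1)[OF f1] wO w'(1)] w'(3) by auto
    have fc: "horner (fs @ [\<one>]) w' \<in> carrier R" "horner_deriv (fs @ [\<one>]) w' \<in> carrier R"
      "horner_deriv (fs @ [\<one>]) w \<in> carrier R" using SO(2)[OF f1] wc w'c by auto
    have 2: "v (horner (fs @ [\<one>]) w') < 1" using 1(1) fs(2) fc by (simp add: a_minus_def)
    have 3: "v (horner_deriv (fs @ [\<one>]) w') = 1" using v_eq_if_close[OF fc(2,3)] 1(2) fs(3) by simp
    have "set (fs @ [\<one>]) \<subseteq> D \<inter> valuation_ring R v" using SO(1,3)[OF f1] D by blast
    then obtain y where y: "y \<in> D" "y \<in> valuation_ring R v" "horner (fs @ [\<one>]) y = \<zero>" "v (y \<ominus> w') < 1"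
      using hensel[OF intermediateD(1)[OF D(1)] complete_on_intermediate[OF D(1)] _ _ 2 3] D w' by blast
    have yc: "y \<in> carrier R" using y by (auto simp: mem_valuation_ring)
    have "v (y \<ominus> w) < 1" using v_triangle[OF yc w'c wc(1)] y w' by simp
    then have "y = w" using simple_root_unique[OF SO(1)[OF f1] wO y(2) fs(2) y(3) fs(3)] by simp
    then show ?thesis using y by simp
  qed
  then have "simple_extension C w \<subseteq> D" using simple_extension_subset[OF D(1,2)] by simp
  then have "value_set (simple_extension C w) \<subseteq> value_set C" using D_values value_set_mono by blast
  moreover have "value_set C \<subseteq> value_set (simple_extension C w)"
    using value_set_mono intermediate_simple_extension[OF C wc(1)] by blast
  ultimately show ?thesis by blast
qed

end

section \<open>Separability and simple residual roots\<close>

context field begin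

text \<open>Taylor expansion of the polynomial \<open>p\<close>, seen as its own value at \<open>X\<close>,
  around the constant \<open>a\<close>.\<close>

lemma two_le_alg_mult:
  assumes p: "p \<in> carrier (poly_ring R)" "p \<noteq> []" and a: "a \<in> carrier R"
    and root: "horner (rev p) a = \<zero>" "horner_deriv (rev p) a = \<zero>"
  shows "2 \<le> alg_mult p a"
proof -
  let ?U = "poly_ring R"
  interpret U: domain ?U using univ_poly_is_domain[OF carrier_is_subring] .
  interpret c: ring_hom_ring R ?U poly_of_const
    using canonical_embedding_ring_hom[OF carrier_is_subring] by simp
  have pc: "set p \<subseteq> carrier R" using p(1) polynomial_incl unfolding univ_poly_carrier[symmetric] by blast
  define \<alpha> where "\<alpha> = poly_of_const a"
  define \<delta> where "\<delta> = [\<one>, \<ominus> a]"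
  have \<alpha>: "\<alpha> \<in> carrier ?U" using a by (simp add: \<alpha>_def)
  have X: "X \<in> carrier ?U" using var_closed(1)[OF carrier_is_subring] .
  have \<delta>: "\<delta> \<in> carrier ?U"
    using a by (simp add: \<delta>_def univ_poly_carrier[symmetric] polynomial_def)
  have sum: "\<alpha> \<oplus>\<^bsub>?U\<^esub> \<delta> = X"
    using a by (auto simp: \<alpha>_def \<delta>_def poly_of_const_def univ_poly_add var_def l_neg)
  define cs where "cs = map poly_of_const (rev p)"
  have cs: "set cs \<subseteq> carrier ?U" using pc by (auto simp: cs_def)
  obtain t where t: "t \<in> carrier ?U"
    "U.horner cs (\<alpha> \<oplus>\<^bsub>?U\<^esub> \<delta>) = U.horner cs \<alpha> \<oplus>\<^bsub>?U\<^esub> \<delta> \<otimes>\<^bsub>?U\<^esub> U.horner_deriv cs \<alpha> \<oplus>\<^bsub>?U\<^esub> \<delta> \<otimes>\<^bsub>?U\<^esub> \<delta> \<otimes>\<^bsub>?U\<^esub> t"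
    using U.horner_taylor[OF U.carrier_is_subring cs \<alpha> \<delta>] by auto
  have "U.horner cs X = p"
    using U.eval_rev_eq_horner[OF cs X] eval_rewrite[OF carrier_is_subring p(1)] 
    by (simp add: cs_def rev_map)
  moreover have "U.horner cs \<alpha> = \<zero>\<^bsub>?U\<^esub>" "U.horner_deriv cs \<alpha> = \<zero>\<^bsub>?U\<^esub>"
    using c.horner_hom[of "rev p" a] pc a root by (simp_all add: cs_def \<alpha>_def)
  ultimately have "p = \<delta> \<otimes>\<^bsub>?U\<^esub> \<delta> \<otimes>\<^bsub>?U\<^esub> t" using t \<delta> unfolding sum by simp
  moreover have "\<delta> [^]\<^bsub>?U\<^esub> (2::nat) = \<delta> \<otimes>\<^bsub>?U\<^esub> \<delta>" using \<delta> by (simp add: numeral_2_eq_2)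
  ultimately have "(\<delta> [^]\<^bsub>?U\<^esub> (2::nat)) pdivides p"
    using t(1) unfolding pdivides_def factor_def by auto
  then show ?thesis using alg_multE(2)[OF a p] unfolding \<delta>_def by blast
qed

text \<open>If the derivative vanished, \<open>x\<close> would be a double root of its minimal polynomial in
  the algebraic closure.\<close>

lemma separable_over_imp_simple_root:
  assumes k: "subfield k R" and x: "x \<in> carrier R" and sep: "separable_over R k x"
  shows "horner_deriv (rev (Irr k x)) x \<noteq> \<zero>"
proof
  assume zero: "horner_deriv (rev (Irr k x)) x = \<zero>"
  let ?A = "alg_closure" and ?i = "indexed_const"
  interpret A: algebraic_closure ?A "?i ` carrier R" using alg_closureE(1) .
  interpret i: ring_hom_ring R ?A ?i
    using alg_closureE(2) by (intro ring_hom_ringI2 ring_axioms A.ring_axioms)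
  have alg: "(algebraic over k) x" using sep by (simp add: separable_over_def)
  define p where "p = Irr k x"
  have p: "p \<in> carrier (k[X])" "pirreducible k p" "eval p x = \<zero>"
    using IrrE[OF k x alg] by (auto simp: p_def)
  have p_ne: "p \<noteq> []"
    using IrrE(3)[OF k x alg] p pirreducibleE(1)[OF subfieldE(1)[OF k] p(1,2)] by auto
  have pR: "p \<in> carrier (poly_ring R)"
    using carrier_polynomial_shell[OF subfieldE(1)[OF k] p(1)] .
  have pc: "set p \<subseteq> carrier R" using pR polynomial_incl unfolding univ_poly_carrier[symmetric] by blast
  have q: "map ?i p \<in> carrier (poly_ring ?A)" 
    using polynomial_hom[OF i.homh field_axioms A.field_axioms pR] .
  have "horner (rev p) x = \<zero>" using eval_rev_eq_horner[of "rev p" x] pc x p(3) by simp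
  then have "A.horner (rev (map ?i p)) (?i x) = \<zero>\<^bsub>?A\<^esub>" "A.horner_deriv (rev (map ?i p)) (?i x) = \<zero>\<^bsub>?A\<^esub>"
    using i.horner_hom[of "rev p" x] pc x zero by (simp_all add: rev_map p_def)
  then have "2 \<le> A.alg_mult (map ?i p) (?i x)"
    using q p_ne x by (intro A.two_le_alg_mult) auto
  moreover have "A.alg_mult (map ?i p) (?i x) \<le> 1"
    using sep x by (simp add: separable_over_def p_def)
  ultimately show False by simp
qed

end

lemma (in ring) horner_consistent:
  assumes "subring S R"
  shows "ring.horner (R\<lparr>carrier := S\<rparr>) cs x = horner cs x"
    "ring.horner_deriv (R\<lparr>carrier := S\<rparr>) cs x = horner_deriv cs x"
proof -
  interpret S: ring "R\<lparr>carrier := S\<rparr>" by (rule subring_is_ring[OF assms])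
  have "S.horner cs x = horner cs x \<and> S.horner_deriv cs x = horner_deriv cs x"
    by (induction cs) auto
  then show "S.horner cs x = horner cs x" "S.horner_deriv cs x = horner_deriv cs x" by auto
qed

context ultrametric_field begin

lemma valuation_ring_subfield:
  "C \<subseteq> carrier R \<Longrightarrow> valuation_ring (R\<lparr>carrier := C\<rparr>) v = C \<inter> valuation_ring R v"
  by (auto simp: valuation_ring_def)

text \<open>The quotient is a field because an integral element outside the valuation ideal has value 1, so its
  inverse is integral as well.\<close>

lemma residue_field_properties:
  fixes C
  assumes C: "subfield C R"
  defines "A \<equiv> R\<lparr>carrier := C \<inter> valuation_ring R v\<rparr>"
    and "E \<equiv> residue_field (R\<lparr>carrier := C\<rparr>) v"
    and "h \<equiv> (\<lambda>x. valuation_ideal (R\<lparr>carrier := C\<rparr>) v +>\<^bsub>R\<^esub> x)"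
  shows "ring_hom_ring A E h" "field E" "\<And>x. x \<in> C \<Longrightarrow> v x \<le> 1 \<Longrightarrow> h x = \<zero>\<^bsub>E\<^esub> \<longleftrightarrow> v x < 1"
proof -
  define S where "S = C \<inter> valuation_ring R v"
  define m where "m = valuation_ideal (R\<lparr>carrier := C\<rparr>) v"
  note C' = subringE[OF subfieldE(1)[OF C]]
  have S: "subring S R" using subring_inter[OF subfieldE(1)[OF C] subring_valuation_ring] by (simp add: S_def)
  note S' = subringE[OF S]
  have mem_S: "x \<in> S \<longleftrightarrow> x \<in> C \<and> v x \<le> 1" for x using C'(1) by (auto simp: S_def mem_valuation_ring)
  have mem_m: "x \<in> m \<longleftrightarrow> x \<in> C \<and> v x < 1" for x by (auto simp: m_def valuation_ideal_def)
  have car: "x \<in> carrier R" if "x \<in> C" for x using C'(1) that by auto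
  have "subcring S R" using subcringI[OF S] m_comm S'(1) by blast
  then interpret A: cring A using subcring_iff S'(1) unfolding A_def S_def by blast
  have A_simps: "carrier A = S" "\<And>x y. x \<otimes>\<^bsub>A\<^esub> y = x \<otimes> y" "\<And>x y. x \<oplus>\<^bsub>A\<^esub> y = x \<oplus> y" "\<one>\<^bsub>A\<^esub> = \<one>" "\<zero>\<^bsub>A\<^esub> = \<zero>"
    by (auto simp: A_def S_def)
  have A_neg: "\<ominus>\<^bsub>A\<^esub> x = \<ominus> x" if "x \<in> S" for x
    using that S' A.minus_equality[of "\<ominus> x" x] by (auto simp: A_simps l_neg subset_iff)
  have ideal: "ideal m A"
  proof (rule idealI)
    show "ring A" by (rule A.ring_axioms)
    show "subgroup m (add_monoid A)"
    proof (rule A.add.subgroupI)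
      show "m \<subseteq> carrier A" by (auto simp: A_simps mem_m mem_S)
      show "m \<noteq> {}" using mem_m[of \<zero>] C' by auto
      show "\<ominus>\<^bsub>A\<^esub> x \<in> m" if "x \<in> m" for x
      proof -
        have "\<ominus>\<^bsub>A\<^esub> x = \<ominus> x" using A_neg[of x] that by (simp add: mem_m mem_S)
        then show ?thesis using that C'(5)[of x] car[of x] by (simp add: mem_m)
      qed
      show "x \<oplus>\<^bsub>A\<^esub> y \<in> m" if "x \<in> m" "y \<in> m" for x y
        using that C'(7)[of x y] car[of x] car[of y] v_add_le_max[of x y] by (auto simp add: mem_m A_simps)
    qed
    show prod: "x \<otimes>\<^bsub>A\<^esub> a \<in> m" if "a \<in> m" "x \<in> carrier A" for a x
    proof -
      have xa: "x \<in> C" "v x \<le> 1" "a \<in> C" "v a < 1" using that by (simp_all add: mem_m mem_S A_simps)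
      then have "v x * v a \<le> v a" using car[of x] car[of a] by (simp add: mult_left_le_one_le)
      then show ?thesis using xa C'(6)[of x a] car[of x] car[of a] by (simp add: mem_m A_simps)
    qed
    show "a \<otimes>\<^bsub>A\<^esub> x \<in> m" if "a \<in> m" "x \<in> carrier A" for a x
      using prod[OF that] A.m_comm[of a x] that by (auto simp: A_simps mem_m mem_S)
  qed
  then interpret m: ideal m A .
  have E: "E = A Quot m"
    using valuation_ring_subfield[OF C'(1)] by (simp add: E_def residue_field_def A_def m_def)
  have h: "h = (+>\<^bsub>A\<^esub>) m"
    by (auto simp: h_def m_def A_def a_r_coset_def r_coset_def fun_eq_iff)
  show "ring_hom_ring A E h" unfolding E h by (rule m.rcos_ring_hom_ring)
  have "maximalideal m A"
  proof (rule maximalidealI[OF ideal])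
    show "carrier A \<noteq> m" using S'(3) mem_m[of \<one>] by (auto simp: A_simps)
    show "J = m \<or> J = carrier A" if J: "ideal J A" "m \<subseteq> J" "J \<subseteq> carrier A" for J
    proof (rule disjCI)
      assume "J \<noteq> carrier A"
      have "v x < 1" if x: "x \<in> J" for x
      proof (rule ccontr)
        assume "\<not> v x < 1"
        then have xS: "x \<in> C" "v x = 1" using J x by (auto simp: A_simps mem_S)
        then have x0: "x \<noteq> \<zero>" by auto
        have "inv x \<in> S" using subfield_m_inv(1)[OF C, of x] xS x0 car by (simp add: mem_S)
        then have "inv x \<otimes>\<^bsub>A\<^esub> x \<in> J" using ideal.I_l_closed[OF J(1) x] by (simp add: A_simps)
        then have "\<one>\<^bsub>A\<^esub> \<in> J" using car xS x0 by (simp add: A_simps)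
        then show False using ideal.one_imp_carrier[OF J(1)] \<open>J \<noteq> carrier A\<close> by simp
      qed
      then show "J = m" using J by (auto simp: A_simps mem_S mem_m)
    qed
  qed
  then show "field E" unfolding E by (rule maximalideal.quotient_is_field) (rule A.is_cring)
  show "h x = \<zero>\<^bsub>E\<^esub> \<longleftrightarrow> v x < 1" if "x \<in> C" "v x \<le> 1" for x
  proof -
    have "\<zero>\<^bsub>E\<^esub> = m" by (simp add: E FactRing_def)
    moreover have "x \<in> carrier A" using that by (simp add: A_simps mem_S)
    ultimately show ?thesis 
      using m.rcos_const_imp_mem[of x] A.a_rcos_zero[OF ideal, of x] that mem_m unfolding h by auto
  qed
qed

lemma residue_image_subfield:
  assumes C: "subfield C R" and D: "subfield D R" "D \<subseteq> C"
  shows "subfield (residue_image R v C D) (residue_field (R\<lparr>carrier := C\<rparr>) v)"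
proof -
  define A where "A = R\<lparr>carrier := C \<inter> valuation_ring R v\<rparr>"
  define E where "E = residue_field (R\<lparr>carrier := C\<rparr>) v"
  define h where "h = (\<lambda>x. valuation_ideal (R\<lparr>carrier := C\<rparr>) v +>\<^bsub>R\<^esub> x)"
  note props = residue_field_properties[OF C, folded A_def E_def h_def]
  interpret E: field E by (rule props)
  interpret h: ring_hom_ring A E h by (rule props)
  define T where "T = D \<inter> valuation_ring R v"
  have T: "subring T R" using subring_inter[OF subfieldE(1)[OF D(1)] subring_valuation_ring] by (simp add: T_def)
  have TA: "T \<subseteq> carrier A" using D by (auto simp: T_def A_def)
  have "subring T A"
    using subring_is_ring[OF T] TA by (intro h.R.ring_incl_imp_subring) (auto simp: A_def)
  then have sub: "subring (h ` T) E" by (rule h.img_is_subring)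
  have "subfield (h ` T) E"
  proof (rule E.subfieldI'[OF sub])
    fix y assume y: "y \<in> h ` T - {\<zero>\<^bsub>E\<^esub>}"
    then obtain x where x: "x \<in> T" "y = h x" by auto
    then have xc: "x \<in> D" "x \<in> C" "x \<in> carrier R" "v x \<le> 1" 
      using D by (auto simp: T_def mem_valuation_ring)
    have vx: "v x = 1" using props(3)[of x] xc x y by auto
    then have x0: "x \<noteq> \<zero>" by auto
    have i: "inv x \<in> T" using subfield_m_inv(1)[OF D(1), of x] xc x0 vx by (simp add: T_def mem_valuation_ring)
    have "h (inv x) \<otimes>\<^bsub>E\<^esub> h x = h (inv x \<otimes>\<^bsub>A\<^esub> x)" using i x TA h.hom_mult by (metis subsetD)
    also have "\<dots> = \<one>\<^bsub>E\<^esub>" using h.hom_one x0 xc by (simp add: A_def)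
    finally have "h (inv x) \<otimes>\<^bsub>E\<^esub> h x = \<one>\<^bsub>E\<^esub>" .
    moreover have "h (inv x) \<in> carrier E" "h x \<in> carrier E" using i x TA by auto
    ultimately have "h (inv x) = inv\<^bsub>E\<^esub> (h x)" 
      by (intro monoid.inv_unique'[OF E.monoid_axioms]) (auto simp: E.m_comm)
    then show "inv\<^bsub>E\<^esub> y \<in> h ` T" using i x by auto
  qed
  then show ?thesis
    using valuation_ring_subfield[of D] subfieldE(3)[OF D(1)] 
    by (simp add: E_def h_def T_def residue_image_def)
qed

text \<open>Lift the minimal polynomial of the residue of \<open>x\<close> coefficient by coefficient. Its
  derivative does not vanish at the residue of \<open>x\<close>, by separability, so the derivative of the lift
  is a unit at \<open>x\<close>.\<close>

lemma residue_separable_imp_simple_residual_root: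
  assumes C: "subfield C R" and D: "subfield D R" "D \<subseteq> C" and sep: "residue_separable R v C D"
    and x: "x \<in> C" "v x \<le> 1"
  shows "\<exists>cs. set cs \<subseteq> D \<inter> valuation_ring R v \<and> v (horner (cs @ [\<one>]) x) < 1 \<and> v (horner_deriv (cs @ [\<one>]) x) = 1"
proof -
  define S where "S = C \<inter> valuation_ring R v"
  define T where "T = D \<inter> valuation_ring R v"
  define A where "A = R\<lparr>carrier := S\<rparr>"
  define E where "E = residue_field (R\<lparr>carrier := C\<rparr>) v"
  define h where "h = (\<lambda>x. valuation_ideal (R\<lparr>carrier := C\<rparr>) v +>\<^bsub>R\<^esub> x)"
  define k where "k = residue_image R v C D"
  note props = residue_field_properties[OF C, folded S_def, folded A_def E_def h_def]
  interpret E: field E by (rule props)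
  interpret h: ring_hom_ring A E h by (rule props)
  have S: "subring S R" using subring_inter[OF subfieldE(1)[OF C] subring_valuation_ring] by (simp add: S_def)
  note S' = subringE[OF S]
  have TS: "T \<subseteq> S" using D by (auto simp: T_def S_def)
  have xS: "x \<in> S" "x \<in> carrier A" using x subfieldE(3)[OF C] by (auto simp: S_def A_def mem_valuation_ring)
  have k: "subfield k E" using residue_image_subfield[OF C D] by (simp add: k_def E_def)
  have k_eq: "k = h ` T"
    using valuation_ring_subfield[of D] subfieldE(3)[OF D(1)] 
    by (simp add: h_def T_def residue_image_def k_def)
  have hx: "h x \<in> carrier E" using xS by simp
  have sepx: "separable_over E k (h x)"
    using sep hx by (simp add: residue_separable_def separable_extension_def E_def k_def)
  then have alg: "(E.algebraic over k) (h x)" by (simp add: separable_over_def)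
  define p where "p = E.Irr k (h x)"
  note Irr = E.IrrE[OF k hx alg, folded p_def]
  have "p \<noteq> []" using E.pirreducibleE(1)[OF subfieldE(1)[OF k] Irr(1,2)] by auto
  then have p: "p = \<one>\<^bsub>E\<^esub> # tl p" using Irr(3) by (metis list.collapse)
  have "set p \<subseteq> k" using Irr(1) E.polynomial_incl unfolding univ_poly_carrier[symmetric] by blast
  then have "set (tl p) \<subseteq> h ` T" using list.set_sel(2)[OF \<open>p \<noteq> []\<close>] k_eq by blast
  then have "rev (tl p) \<in> lists (h ` T)" by auto
  then obtain cs where cs: "set cs \<subseteq> T" "rev (tl p) = map h cs"
    unfolding lists_image by auto
  have cs1: "set (cs @ [\<one>]) \<subseteq> S" "set (cs @ [\<one>]) \<subseteq> carrier A" using cs(1) TS S'(3) by (auto simp: A_def)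
  have "h \<one> = \<one>\<^bsub>E\<^esub>" using h.hom_one by (simp add: A_def)
  moreover have "rev p = rev (tl p) @ [\<one>\<^bsub>E\<^esub>]" by (subst p) simp
  ultimately have rp: "rev p = map h (cs @ [\<one>])" using cs(2) by simp
  have mem: "horner (cs @ [\<one>]) x \<in> S" "horner_deriv (cs @ [\<one>]) x \<in> S"
    using horner_in_subring[OF S cs1(1) xS(1)] horner_deriv_in_subring[OF S cs1(1) xS(1)] by auto
  then have mem': "horner (cs @ [\<one>]) x \<in> C" "v (horner (cs @ [\<one>]) x) \<le> 1"
    "horner_deriv (cs @ [\<one>]) x \<in> C" "v (horner_deriv (cs @ [\<one>]) x) \<le> 1"
    by (auto simp: S_def mem_valuation_ring)
  have hom: "E.horner (rev p) (h x) = h (horner (cs @ [\<one>]) x)"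
    "E.horner_deriv (rev p) (h x) = h (horner_deriv (cs @ [\<one>]) x)"
    using h.horner_hom[OF cs1(2) xS(2)] horner_consistent[OF S] unfolding rp A_def by auto
  have "set p \<subseteq> carrier E" using \<open>set p \<subseteq> k\<close> subfieldE(3)[OF k] by blast
  then have "E.horner (rev p) (h x) = \<zero>\<^bsub>E\<^esub>"
    using E.eval_rev_eq_horner[of "rev p" "h x"] hx Irr(4) by simp
  then have "v (horner (cs @ [\<one>]) x) < 1" using props(3) mem' unfolding hom by simp
  moreover have "E.horner_deriv (rev p) (h x) \<noteq> \<zero>\<^bsub>E\<^esub>"
    using E.separable_over_imp_simple_root[OF k hx sepx] by (simp add: p_def)
  then have "v (horner_deriv (cs @ [\<one>]) x) = 1" using props(3) mem' unfolding hom by force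
  ultimately show ?thesis using cs(1) unfolding T_def by blast
qed

text \<open>This is how tameness enters: the ramification index \<open>n\<close> becomes a unit of the valuation
  ring, so that \<open>X ^ n - u\<close> has only simple residual roots when \<open>u\<close> is a
  unit.\<close>

lemma v_nat_eq_1:
  assumes C: "subfield C R" and n: "0 < n"
    and p: "ring_characteristic (residue_field (R\<lparr>carrier := C\<rparr>) v) \<noteq> 0 \<longrightarrow>
      \<not> ring_characteristic (residue_field (R\<lparr>carrier := C\<rparr>) v) dvd n"
  shows "v ([n] \<cdot> \<one>) = 1"
proof (rule ccontr)
  assume neq: "v ([n] \<cdot> \<one>) \<noteq> 1"
  define S where "S = C \<inter> valuation_ring R v"
  define A where "A = R\<lparr>carrier := S\<rparr>"
  define E where "E = residue_field (R\<lparr>carrier := C\<rparr>) v"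
  define h where "h = (\<lambda>x. valuation_ideal (R\<lparr>carrier := C\<rparr>) v +>\<^bsub>R\<^esub> x)"
  note props = residue_field_properties[OF C, folded S_def, folded A_def E_def h_def]
  interpret E: field E by (rule props)
  interpret h: ring_hom_ring A E h by (rule props)
  have S: "subring S R" using subring_inter[OF subfieldE(1)[OF C] subring_valuation_ring] by (simp add: S_def)
  note S' = subringE[OF S]
  have A_simps: "\<And>x y. x \<oplus>\<^bsub>A\<^esub> y = x \<oplus> y" "\<one>\<^bsub>A\<^esub> = \<one>" "carrier A = S" "\<zero>\<^bsub>A\<^esub> = \<zero>"
    by (auto simp: A_def)
  have h01: "h \<one> = \<one>\<^bsub>E\<^esub>" "h \<zero> = \<zero>\<^bsub>E\<^esub>" using h.hom_one h.hom_zero by (simp_all add: A_simps)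
  have A: "[k] \<cdot> \<one> \<in> S \<and> h ([k] \<cdot> \<one>) = [k] \<cdot>\<^bsub>E\<^esub> \<one>\<^bsub>E\<^esub>" for k :: nat
  proof (induction k)
    case 0
    then show ?case using S' h01 by simp
  next
    case (Suc k)
    then have "h ([k] \<cdot> \<one> \<oplus> \<one>) = h ([k] \<cdot> \<one>) \<oplus>\<^bsub>E\<^esub> h \<one>"
      using h.hom_add[of "[k] \<cdot> \<one>" \<one>] S' by (simp add: A_simps)
    then show ?case using Suc S' h01 by simp
  qed
  then have "h ([n] \<cdot> \<one>) = \<zero>\<^bsub>E\<^esub>" 
    using neq props(3)[of "[n] \<cdot> \<one>"] by (force simp: S_def mem_valuation_ring)
  then have "[n] \<cdot>\<^bsub>E\<^esub> \<one>\<^bsub>E\<^esub> = \<zero>\<^bsub>E\<^esub>" using A[of n] by simp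
  then show False using E.ring_characteristic_dvd[OF n] p by (simp add: E_def)
qed

lemma v_nat_dvd_eq_1:
  fixes n k :: nat
  assumes "v ([n] \<cdot> \<one>) = 1" "k dvd n"
  shows "v ([k] \<cdot> \<one>) = 1"
proof -
  have le: "v ([i] \<cdot> \<one>) \<le> 1" for i :: nat
  proof (induction i)
    case (Suc i)
    then show ?case using v_add_le_max[of "[i] \<cdot> \<one>" \<one>] by simp
  qed simp
  obtain j where "n = k * j" using assms(2) by auto
  then have "[n] \<cdot> \<one> = [k] \<cdot> ([j] \<cdot> \<one>)"
    by (simp add: add.nat_pow_pow mult.commute)
  also have "\<dots> = ([k] \<cdot> \<one>) \<otimes> ([j] \<cdot> \<one>)"
    by (simp add: add_pow_ldistr)
  finally have "[n] \<cdot> \<one> = ([k] \<cdot> \<one>) \<otimes> ([j] \<cdot> \<one>)" .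
  then have "v ([k] \<cdot> \<one>) * v ([j] \<cdot> \<one>) = 1" using assms by simp
  moreover have "v ([k] \<cdot> \<one>) * v ([j] \<cdot> \<one>) \<le> v ([k] \<cdot> \<one>)" using le by (simp add: mult_left_le)
  ultimately show ?thesis using le[of k] by simp
qed

end

context complete_extension begin

text \<open>Every residue class of \<open>L\<close> contains a representative that generates an unramified
  extension of any field above \<open>K\<close>.\<close>

lemma exists_residually_simple_root_close:
  assumes L: "intermediate L" and sep: "residue_separable R v L K" and x: "x \<in> L" "v x \<le> 1"
  shows "\<exists>s\<in>L. residually_simple_root K s \<and> v (s \<ominus> x) < 1"
proof -
  note L' = intermediateD[OF L]
  obtain cs where cs: "set cs \<subseteq> K \<inter> valuation_ring R v" "v (horner (cs @ [\<one>]) x) < 1" "v (horner_deriv (cs @ [\<one>]) x) = 1"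
    using residue_separable_imp_simple_residual_root[OF L'(1) K L'(2) sep x] by auto
  have cs1: "set (cs @ [\<one>]) \<subseteq> L \<inter> valuation_ring R v" "set (cs @ [\<one>]) \<subseteq> valuation_ring R v"
    "set (cs @ [\<one>]) \<subseteq> carrier R"
    using cs(1) L'(2) subringE(3)[OF L'(3)] one_in_valuation_ring by (auto simp: mem_valuation_ring)
  have xO: "x \<in> valuation_ring R v" "x \<in> carrier R" using x L'(4) by (auto simp: mem_valuation_ring)
  obtain s where s: "s \<in> L" "s \<in> valuation_ring R v" "horner (cs @ [\<one>]) s = \<zero>" "v (s \<ominus> x) < 1"
    using hensel[OF L'(1) complete_on_intermediate[OF L] cs1(1) _ cs(2,3)] x(1) xO by blast
  have sc: "s \<in> carrier R" using s by (simp add: mem_valuation_ring)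
  have dc: "horner_deriv (cs @ [\<one>]) s \<in> carrier R" "horner_deriv (cs @ [\<one>]) x \<in> carrier R"
    using horner_deriv_closed[OF cs1(3)] sc xO by auto
  have "v (horner_deriv (cs @ [\<one>]) s \<ominus> horner_deriv (cs @ [\<one>]) x) < 1"
    using v_horner_diff_le(2)[OF cs1(2) xO(1) s(2)] s(4) by simp
  then have "v (horner_deriv (cs @ [\<one>]) s) = 1" using v_eq_if_close[OF dc] cs(3) by simp
  then show ?thesis using s cs(1) unfolding residually_simple_root_def by blast
qed

text \<open>Root lifting for \<open>X ^ n - u\<close>, starting from the approximate root 1.\<close>

lemma exists_root_of_one_unit:
  fixes n :: nat
  assumes L: "intermediate L" and u: "u \<in> L" "v (u \<ominus> \<one>) < 1" and n: "0 < n" "v ([n] \<cdot> \<one>) = 1"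
  shows "\<exists>t\<in>L. t [^] n = u \<and> v (t \<ominus> \<one>) < 1"
proof -
  note L' = intermediateD[OF L]
  have uc: "u \<in> carrier R" using u L'(4) by blast
  have vu: "v u = 1" using v_eq_if_close[OF uc one_closed] u(2) by simp
  let ?cs = "\<ominus> u # replicate (n - 1) \<zero> @ [\<one>]"
  have cs: "set ?cs \<subseteq> L \<inter> valuation_ring R v"
    using subringE[OF L'(3)] u(1) uc vu by (auto simp: mem_valuation_ring)
  have "v (horner ?cs \<one>) < 1" 
    using horner_binomial(1)[OF n(1) uc one_closed] u(2) uc by (simp add: v_minus_commute)
  moreover have "v (horner_deriv ?cs \<one>) = 1"
    using horner_binomial(2)[OF n(1) uc one_closed] n(2) by simp
  ultimately obtain t where t: "t \<in> L" "t \<in> valuation_ring R v" "horner ?cs t = \<zero>" "v (t \<ominus> \<one>) < 1"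
    using hensel[OF L'(1) complete_on_intermediate[OF L] cs, of \<one>] subringE(3)[OF L'(3)] 
      one_in_valuation_ring by blast
  have tc: "t \<in> carrier R" using t by (simp add: mem_valuation_ring)
  have "t [^] n \<ominus> u = \<zero>" using horner_binomial(1)[OF n(1) uc tc] t(3) by simp
  then show ?thesis using t uc tc by auto
qed

text \<open>The polynomial is \<open>X ^ n - w ^ n\<close>, whose derivative at \<open>w\<close> is a
  unit because \<open>n\<close> and \<open>w\<close> are.\<close>

lemma residually_simple_root_radical:
  fixes n :: nat
  assumes C: "intermediate C" and w: "w \<in> carrier R" "v w = 1" and n: "0 < n" "v ([n] \<cdot> \<one>) = 1"
    and pow: "w [^] n \<in> C"
  shows "residually_simple_root C w"
proof -
  note C' = intermediateD[OF C]
  let ?cs = "\<ominus> (w [^] n) # replicate (n - 1) \<zero>"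
  have "set ?cs \<subseteq> C \<inter> valuation_ring R v"
    using subringE[OF C'(3)] pow w by (auto simp: mem_valuation_ring)
  moreover have wn: "w [^] n \<in> carrier R" using w by simp
  have "horner (?cs @ [\<one>]) w = \<zero>" "v (horner_deriv (?cs @ [\<one>]) w) = 1"
    using horner_binomial[OF n(1) wn w(1)] n(2) w by simp_all
  ultimately show ?thesis using w unfolding residually_simple_root_def
    by (intro conjI exI[of _ ?cs]) (simp_all add: mem_valuation_ring del: append_Cons)
qed

end

section \<open>Discrete multiplicative groups of positive reals\<close>

definition zpowers :: "real \<Rightarrow> real set" where
  "zpowers r = range (\<lambda>k::int. r powi k)"

lemma power_mem_zpowers: "r ^ n \<in> zpowers r"
  unfolding zpowers_def by (intro range_eqI[of _ _ "int n"]) (simp add: power_int_of_nat)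

lemma powi_eq_iff:
  fixes r :: real
  assumes "0 < r" "r < 1"
  shows "r powi k = r powi l \<longleftrightarrow> k = l"
proof -
  have "r powi k \<noteq> r powi l" if "k < l" for k l
    using power_int_strict_decreasing[of k l r] that assms by force
  then show ?thesis by (metis linorder_cases)
qed

text \<open>The gap \<open>c\<close> forces the supremum of the elements below 1 to be attained; it is a
  generator.\<close>

lemma cyclic_if_gap:
  fixes G :: "real set"
  assumes one: "1 \<in> G" and mult: "\<And>a b. a \<in> G \<Longrightarrow> b \<in> G \<Longrightarrow> a * b \<in> G"
    and inv: "\<And>a. a \<in> G \<Longrightarrow> inverse a \<in> G" and pos: "\<And>a. a \<in> G \<Longrightarrow> 0 < a"
    and c: "0 < c" "c < 1" and gap: "\<And>a. a \<in> G \<Longrightarrow> a < 1 \<Longrightarrow> a \<le> c" and nontrivial: "G \<noteq> {1}"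
  shows "\<exists>r. 0 < r \<and> r < 1 \<and> G = zpowers r"
proof -
  define H where "H = {a \<in> G. a < 1}"
  obtain a where "a \<in> G" "a \<noteq> 1" using nontrivial one by auto
  then have "a \<in> H \<or> inverse a \<in> H"
    using inv[of a] pos[of a] by (auto simp: H_def one_less_inverse_iff inverse_less_1_iff)
  then obtain h where h: "h \<in> H" by auto
  have bdd: "bdd_above H" by (intro bdd_aboveI[of _ 1]) (auto simp: H_def)
  define r where "r = Sup H"
  have r_up: "a \<le> r" if "a \<in> H" for a unfolding r_def using that bdd by (rule cSup_upper)
  have r_pos: "0 < r" using r_up[OF h] pos[of h] h by (auto simp: H_def)
  have "r \<le> c" unfolding r_def using h gap by (intro cSup_least) (auto simp: H_def)
  then have r1: "r < 1" using c by simp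
  have quot: "a / b \<in> G" if "a \<in> G" "b \<in> G" for a b
    using mult[OF that(1) inv[OF that(2)]] by (simp add: divide_inverse)
  have rG: "r \<in> G"
  proof (rule ccontr)
    assume r: "r \<notin> G"
    have "r * c < r" using r_pos c by simp
    then obtain a where a: "a \<in> H" "r * c < a" unfolding r_def using less_cSupD[of H] h by blast
    then have "a < r" using r r_up[of a] by (auto simp: H_def order_less_le)
    then obtain b where b: "b \<in> H" "a < b" unfolding r_def using less_cSupD[of H] h by blast
    have ab: "0 < a" "0 < b" using a b pos by (auto simp: H_def)
    then have "a / b \<le> c" using quot[of a b] a b gap by (auto simp: H_def)
    then have "a \<le> b * c" using ab by (simp add: field_simps)
    also have "\<dots> \<le> r * c" using r_up[OF b(1)] c by simp
    finally show False using a by simp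
  qed
  have powi: "r powi k \<in> G" for k
  proof (cases "0 \<le> k")
    case True
    then have "r powi k = r ^ nat k" by (simp add: power_int_def)
    moreover have "r ^ n \<in> G" for n by (induction n) (auto simp: one mult rG)
    ultimately show ?thesis by simp
  next
    case False
    then have "r powi k = inverse r ^ nat (- k)" by (simp add: power_int_def)
    moreover have "inverse r ^ n \<in> G" for n by (induction n) (auto simp: one mult rG inv)
    ultimately show ?thesis by simp
  qed
  have "a \<in> zpowers r" if a: "a \<in> G" for a
  proof -
    have a_pos: "0 < a" using pos a by simp
    define k where "k = \<lfloor>log r a\<rfloor>"
    have powi_powr: "r powi j = r powr j" for j using r_pos by (simp add: powr_real_of_int')
    have "a = r powr log r a" using a_pos r_pos r1 by simp
    moreover have "r powr log r a \<le> r powr k" 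
      using r_pos r1 by (intro powr_mono') (auto simp: k_def)
    ultimately have "a \<le> r powi k" by (simp add: powi_powr)
    have "r powr (k + 1) < r powr log r a"
      using r_pos r1 by (intro powr_less_mono') (auto simp: k_def)
    then have "r * r powi k < a" 
      using \<open>a = r powr log r a\<close> r_pos by (simp add: powi_powr powr_add mult.commute)
    then have "r < a / r powi k" using r_pos by (simp add: field_simps)
    moreover have "a / r powi k \<in> G" using quot a powi by simp
    ultimately have "\<not> a / r powi k < 1" using r_up[of "a / r powi k"] by (auto simp: H_def)
    then have "a = r powi k" using \<open>a \<le> r powi k\<close> r_pos by (simp add: field_simps)
    then show ?thesis by (auto simp: zpowers_def)
  qed
  then have "G = zpowers r" using powi by (auto simp: zpowers_def)
  then show ?thesis using r_pos r1 by blast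
qed

text \<open>The least positive exponent \<open>m\<close> with \<open>r ^ m \<in> H\<close> divides all
  exponents of \<open>H\<close>.\<close>

lemma subgroup_zpowers:
  assumes r: "0 < r" "r < 1" and H: "H \<subseteq> zpowers r"
    and mult: "\<And>a b. a \<in> H \<Longrightarrow> b \<in> H \<Longrightarrow> a * b \<in> H" and inv: "\<And>a. a \<in> H \<Longrightarrow> inverse a \<in> H"
    and n: "0 < n" "r ^ n \<in> H"
  shows "\<exists>m>0. H = zpowers (r ^ m)"
proof -
  define m where "m = (LEAST m. 0 < m \<and> r ^ m \<in> H)"
  have m: "0 < m" "r ^ m \<in> H" using LeastI[of "\<lambda>m. 0 < m \<and> r ^ m \<in> H" n] n unfolding m_def by auto
  have one: "1 \<in> H" using mult[OF m(2) inv[OF m(2)]] r by simp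
  have powi: "(r ^ m) powi k \<in> H" for k
  proof (cases "0 \<le> k")
    case True
    then have "(r ^ m) powi k = (r ^ m) ^ nat k" by (simp add: power_int_def)
    moreover have "(r ^ m) ^ i \<in> H" for i by (induction i) (auto simp: one mult m)
    ultimately show ?thesis by simp
  next
    case False
    then have "(r ^ m) powi k = inverse (r ^ m) ^ nat (- k)" by (simp add: power_int_def)
    moreover have "inverse (r ^ m) ^ i \<in> H" for i using inv[OF m(2)] by (induction i) (auto simp: one mult)
    ultimately show ?thesis by simp
  qed
  have eq: "(r ^ m) powi k = r powi (int m * k)" for k
    by (simp add: power_int_mult power_int_of_nat)
  have "a \<in> zpowers (r ^ m)" if a: "a \<in> H" for a
  proof -
    obtain j where j: "a = r powi j" using a H by (auto simp: zpowers_def)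
    define q where "q = j div int m"
    define s where "s = nat (j mod int m)"
    have s: "int s = j mod int m" "s < m" using m by (auto simp: s_def nat_less_iff)
    have "j = int m * q + int s" unfolding s q_def by simp
    then have "a = (r ^ m) powi q * r ^ s"
      unfolding j eq using r by (simp add: power_int_add power_int_of_nat)
    then have "r ^ s = a * inverse ((r ^ m) powi q)" using r by (simp add: field_simps)
    then have "r ^ s \<in> H" using mult a inv powi by simp
    then have "s = 0" using not_less_Least[of s "\<lambda>m. 0 < m \<and> r ^ m \<in> H"] s(2) unfolding m_def[symmetric] by auto
    then show ?thesis using \<open>a = (r ^ m) powi q * r ^ s\<close> by (auto simp: zpowers_def)
  qed
  then show ?thesis using m powi by (auto simp: zpowers_def)
qed

lemma zpowers_subset_iff_dvd:
  assumes r: "0 < r" "r < 1"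
  shows "r ^ a \<in> zpowers (r ^ b) \<longleftrightarrow> b dvd a"
proof
  assume "r ^ a \<in> zpowers (r ^ b)"
  then obtain k where "r ^ a = (r ^ b) powi k" by (auto simp: zpowers_def)
  then have "r powi (int a) = r powi (int b * k)" by (simp add: power_int_mult power_int_of_nat)
  then show "b dvd a" using powi_eq_iff[OF r] by (metis dvd_triv_left int_dvd_int_iff)
next
  assume "b dvd a"
  then show "r ^ a \<in> zpowers (r ^ b)" using power_mem_zpowers by (auto simp: power_mult)
qed

text \<open>The coset of \<open>r powi k\<close> consists of the powers whose exponents are congruent to
  \<open>k\<close> modulo \<open>j\<close>.\<close>

lemma card_cosets_zpowers:
  assumes r: "0 < r" "r < 1" and j: "0 < j"
  shows "card ((\<lambda>g. (\<lambda>h. h * g) ` zpowers (r ^ j)) ` zpowers r) = j"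
proof -
  define f where "f = (\<lambda>k::int. (\<lambda>h. h * r powi k) ` zpowers (r ^ j))"
  have f: "f k = {r powi i | i. i mod int j = k mod int j}" for k
  proof -
    have "f k = range (\<lambda>l. r powi (int j * l + k))"
      using r by (simp add: f_def zpowers_def image_image power_int_add power_int_mult power_int_of_nat)
    moreover have "\<exists>l. i = int j * l + k" if "i mod int j = k mod int j" for i
      using that by (metis mod_eqE add.commute diff_add_cancel mod_eq_dvd_iff dvd_def)
    ultimately show ?thesis by fastforce
  qed
  have "(\<lambda>g. (\<lambda>h. h * g) ` zpowers (r ^ j)) ` zpowers r = range f"
    by (simp add: f_def zpowers_def image_image)
  also have "\<dots> = f ` {0..<int j}"
  proof -
    have "f k = f (k mod int j)" for k by (simp add: f)
    moreover have "k mod int j \<in> {0..<int j}" for k using j by simp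
    ultimately show ?thesis by blast
  qed
  also have "card \<dots> = card {0..<int j}"
  proof (rule card_image, rule inj_onI)
    fix k l assume kl: "k \<in> {0..<int j}" "l \<in> {0..<int j}" "f k = f l"
    have "r powi k \<in> f k" by (auto simp: f)
    then have "r powi k \<in> f l" using kl by simp
    then show "k = l" using powi_eq_iff[OF r] kl by (auto simp: f)
  qed
  finally show ?thesis by simp
qed

lemma zpowers_mult_closed:
  assumes "r \<noteq> 0" "a \<in> zpowers r" "b \<in> zpowers r"
  shows "a * b \<in> zpowers r"
proof -
  obtain k l where "a = r powi k" "b = r powi l" using assms(2,3) by (auto simp: zpowers_def)
  then have "a * b = r powi (k + l)" using assms(1) by (simp add: power_int_add)
  then show ?thesis by (auto simp: zpowers_def)
qed

lemma zpowers_power_subset: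
  assumes "d dvd m"
  shows "zpowers (r ^ m) \<subseteq> zpowers (r ^ d)"
proof -
  obtain k where k: "m = d * k" using assms by auto
  have "(r ^ m) powi j = (r ^ d) powi (int k * j)" for j
    by (simp add: k power_mult power_int_mult)
  then show ?thesis by (auto simp: zpowers_def)
qed

lemma (in ultrametric_field) ramification_index_eq_card:
  "ramification_index R v U V = card ((\<lambda>g. (\<lambda>h. h * g) ` value_set V) ` value_set U)"
proof -
  have "rcosets\<^bsub>value_group (R\<lparr>carrier := U\<rparr>) v\<^esub> carrier (value_group (R\<lparr>carrier := V\<rparr>) v)
    = (\<lambda>g. (\<lambda>h. h * g) ` value_set V) ` value_set U"
    by (auto simp: RCOSETS_def r_coset_def value_group_def value_set_def)
  then show ?thesis by (simp add: ramification_index_def)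
qed

context complete_extension begin

text \<open>A nonzero \<open>x\<close> satisfies a polynomial equation of degree at most \<open>d\<close>, the
  dimension over \<open>K\<close>, and two of its terms must have equal value; so \<open>|x| ^ i\<close> is a
  value of \<open>K\<close> for some \<open>0 < i \<le> d\<close>, and \<open>fact d\<close> is a common
  multiple of all such \<open>i\<close>.\<close>

lemma exists_common_exponent: "\<exists>n>0. \<forall>a\<in>value_set (carrier R). a ^ n \<in> value_set K"
proof -
  obtain d where d: "dimension d K (carrier R)" using finite_dim by (auto simp: finite_dimension_def)
  have "\<exists>i. 0 < i \<and> i \<le> d \<and> v x ^ i \<in> value_set K" if x: "x \<in> carrier R" "x \<noteq> \<zero>" for x
  proof (rule ccontr)
    assume no: "\<not> ?thesis"
    have alg: "(algebraic over K) x"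
      using finite_dimension_imp_algebraic[OF K carrier_is_subring finite_dim x(1)] .
    define p where "p = Irr K x"
    note Irr = IrrE[OF K x(1) alg, folded p_def]
    have "independent K (exp_base x (degree p))" unfolding p_def by (rule exp_base_independent[OF K x(1) alg])
    moreover from this have "set (exp_base x (degree p)) \<subseteq> carrier R" by (rule independent_in_carrier)
    ultimately have "length (exp_base x (degree p)) \<le> d" by (rule independent_length_le_dimension[OF K d])
    then have len: "length (rev p) \<le> Suc d" by (simp add: exp_base_def)
    have pK: "set p \<subseteq> K" using Irr(1) polynomial_incl unfolding univ_poly_carrier[symmetric] by blast
    then have pc: "set p \<subseteq> carrier R" using subfieldE(3)[OF K] by blast
    have "p \<noteq> []" using pirreducibleE(1)[OF subfieldE(1)[OF K] Irr(1,2)] by auto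
    then have "\<one> \<in> set (rev p)" using Irr(3) by (metis list.set_sel(1) set_rev)
    then have "\<not> set (rev p) \<subseteq> {\<zero>}" by auto
    moreover have "v x ^ i \<notin> value_set K" if "0 < i" "i < Suc d" for i
      using no that by (auto simp: less_Suc_eq_le)
    ultimately obtain c i where "c \<in> value_set K" "v (horner (rev p) x) = c * v x ^ i"
      using v_horner_dominant[OF K x, of "Suc d" "rev p"] pK len by auto
    moreover have "horner (rev p) x = \<zero>" using eval_rev_eq_horner[of "rev p" x] pc x Irr(4) by simp
    ultimately have "c * v x ^ i = 0" "0 < c" using value_set_subfield(4)[OF K] by auto
    then show False using x by simp
  qed
  moreover have "v x ^ fact d \<in> value_set K" if "0 < i" "i \<le> d" "v x ^ i \<in> value_set K" for x i
  proof -
    have "i dvd fact d" using that by (intro dvd_fact) auto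
    then obtain k where k: "fact d = i * k" by auto
    show ?thesis unfolding k power_mult by (rule value_set_subfield(5)[OF K that(3)])
  qed
  ultimately have "\<forall>a\<in>value_set (carrier R). a ^ fact d \<in> value_set K"
    by (fastforce simp: value_set_def[of "carrier R"])
  then show ?thesis by (intro exI[of _ "fact d"]) simp
qed

text \<open>Discreteness passes from \<open>K\<close> to the extension: if \<open>a < 1\<close> then
  \<open>a ^ n\<close> is a value of \<open>K\<close>, so it is at most \<open>1 - e'\<close>, and
  Bernoulli's inequality bounds \<open>a\<close>.\<close>

lemma exists_value_gap:
  assumes "discrete (value_set K)"
  shows "\<exists>c. 0 < c \<and> c < 1 \<and> (\<forall>a\<in>value_set (carrier R). a < 1 \<longrightarrow> a \<le> c)"
proof -
  have "1 isolated_in value_set K"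
    using assms value_set_subfield(1)[OF K] by (rule discreteD)
  then obtain e where e: "e > 0" "\<And>y. y \<in> value_set K \<Longrightarrow> dist 1 y < e \<Longrightarrow> y = 1"
    by (auto simp: isolated_in_dist_Ex_iff)
  obtain n where n: "0 < n" "\<And>a. a \<in> value_set (carrier R) \<Longrightarrow> a ^ n \<in> value_set K"
    using exists_common_exponent by auto
  define e' where "e' = min e (1/2)"
  define c where "c = 1 - e' / real n"
  have e': "0 < e'" "e' \<le> 1/2" "e' \<le> e" using e by (auto simp: e'_def)
  have en: "e' / real n \<le> e'" using n e' by (simp add: field_simps)
  have c: "0 < c" "c < 1" using e' en n by (auto simp: c_def)
  have "a \<le> c" if a: "a \<in> value_set (carrier R)" "a < 1" for a
  proof (rule ccontr)
    assume "\<not> a \<le> c"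
    then have "c ^ n < a ^ n" using c n by (intro power_strict_mono) auto
    moreover have "1 - e' \<le> c ^ n"
      using Bernoulli_inequality[of "- (e' / real n)" n] en e' n by (simp add: c_def)
    moreover have "0 < a" using value_set_subfield(4)[OF carrier_is_subfield a(1)] .
    then have "a ^ n < 1" using a n by (simp add: power_less_one_iff)
    ultimately have "dist 1 (a ^ n) < e" using e' by (simp add: dist_real_def)
    then show False using e(2)[OF n(2)[OF a(1)]] \<open>a ^ n < 1\<close> by simp
  qed
  then show ?thesis using c by blast
qed

end

section \<open>Value groups of tame composita\<close>

context complete_extension begin

text \<open>Successive approximation: iterating the hypothesis shows that \<open>D\<close> is dense in
  \<open>L\<close>, and \<open>D\<close> is complete.\<close>

lemma intermediate_subset_if_approximable:
  assumes L: "intermediate L" and D: "intermediate D" "D \<subseteq> L" and c: "0 < c" "c < 1"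
    and approx: "\<And>x. x \<in> L \<Longrightarrow> \<exists>y\<in>D. v (x \<ominus> y) \<le> c * v x"
  shows "L \<subseteq> D"
proof
  fix x assume x: "x \<in> L"
  note L' = intermediateD[OF L] and D' = intermediateD[OF D(1)]
  obtain f where f: "\<And>z. z \<in> L \<Longrightarrow> f z \<in> D" "\<And>z. z \<in> L \<Longrightarrow> v (z \<ominus> f z) \<le> c * v z"
    using approx by metis
  define s where "s = rec_nat \<zero> (\<lambda>_ y. y \<oplus> f (x \<ominus> y))"
  have s: "s 0 = \<zero>" "\<And>n. s (Suc n) = s n \<oplus> f (x \<ominus> s n)" by (simp_all add: s_def)
  have xc: "x \<in> carrier R" using x L'(4) by blast
  have Dc: "y \<in> carrier R" if "y \<in> D" for y using that D'(4) by blast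
  have minus_L: "x \<ominus> y \<in> L" if "y \<in> D" for y
    using subringE(5,7)[OF L'(3)] x that D(2) unfolding a_minus_def by blast
  have sD: "s n \<in> D \<and> v (x \<ominus> s n) \<le> c ^ n * v x" for n
  proof (induction n)
    case 0
    then show ?case using subringE(2)[OF D'(3)] xc by (simp add: s a_minus_def)
  next
    case (Suc n)
    have sn: "s n \<in> D" "s n \<in> carrier R" "x \<ominus> s n \<in> L" using Suc Dc minus_L by auto
    have fn: "f (x \<ominus> s n) \<in> D" "f (x \<ominus> s n) \<in> carrier R" using f(1) sn(3) Dc by auto
    have "x \<ominus> s (Suc n) = (x \<ominus> s n) \<ominus> f (x \<ominus> s n)"
      unfolding s using sn(2) fn(2) xc by algebra
    then have "v (x \<ominus> s (Suc n)) \<le> c * v (x \<ominus> s n)" using f(2)[OF sn(3)] by simp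
    also have "\<dots> \<le> c * (c ^ n * v x)" using Suc c by (intro mult_left_mono) auto
    finally show ?case using subringE(7)[OF D'(3) sn(1) fn(1)] by (simp add: s(2))
  qed
  have rs: "range s \<subseteq> D" "range s \<subseteq> carrier R" using sD Dc by auto
  have "(\<lambda>n. c ^ n * v x) \<longlonglongrightarrow> 0 * v x" using c by (intro tendsto_mult LIMSEQ_realpow_zero) auto
  then have bound: "(\<lambda>n. c ^ n * v x) \<longlonglongrightarrow> 0" by simp
  have lim: "(\<lambda>n. v (s n \<ominus> x)) \<longlonglongrightarrow> 0"
  proof (rule tendsto_sandwich[OF _ _ tendsto_const bound])
    show "\<forall>\<^sub>F n in sequentially. 0 \<le> v (s n \<ominus> x)" using sD Dc xc by simp
    have "v (s n \<ominus> x) \<le> c ^ n * v x" for n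
      using sD[of n] Dc[of "s n"] v_minus_commute[OF xc, of "s n"] by simp
    then show "\<forall>\<^sub>F n in sequentially. v (s n \<ominus> x) \<le> c ^ n * v x" by simp
  qed
  obtain l where l: "l \<in> D" "(\<lambda>n. v (s n \<ominus> l)) \<longlonglongrightarrow> 0"
    using complete_on_intermediate[OF D(1)] rs(1) convergent_imp_cauchy_seq[OF rs(2) xc lim]
    unfolding complete_on_def by blast
  have "l = x" using limit_unique[OF rs(2) Dc[OF l(1)] xc l(2) lim] .
  then show "x \<in> D" using l by simp
qed

text \<open>Maximality is a matter of dimension over \<open>K\<close>, which is bounded.\<close>

lemma exists_maximal_extension_same_value_set:
  assumes M: "intermediate M" "M \<subseteq> F" and F: "intermediate F"
  shows "\<exists>B. intermediate B \<and> M \<subseteq> B \<and> B \<subseteq> F \<and> value_set B = value_set M \<and>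
    (\<forall>B'. intermediate B' \<and> B \<subseteq> B' \<and> B' \<subseteq> F \<and> value_set B' = value_set M \<longrightarrow> B' = B)"
proof -
  obtain d where d: "dimension d K (carrier R)" using finite_dim by (auto simp: finite_dimension_def)
  define P where "P = (\<lambda>n. \<exists>B. intermediate B \<and> M \<subseteq> B \<and> B \<subseteq> F \<and> value_set B = value_set M \<and> dimension n K B)"
  have le: "m \<le> n" if dim: "dimension m K B" "dimension n K B'" and sub: "B \<subseteq> B'" for m n B B'
  proof -
    obtain Us where Us: "independent K Us" "length Us = m" "Span K Us = B" "set Us \<subseteq> carrier R"
      using exists_base[OF K dim(1)] by auto
    then have "set Us \<subseteq> B'" using Span_base_incl[OF K Us(4)] sub by auto
    then show ?thesis using independent_length_le_dimension[OF K dim(2) Us(1)] Us(2) by simp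
  qed
  obtain m where "dimension m K M" using finite_dimension_intermediate[OF M(1)] by (auto simp: finite_dimension_def)
  then have "P m" using M unfolding P_def by blast
  moreover have "n \<le> d" if "P n" for n
  proof -
    obtain B where "intermediate B" "dimension n K B" using \<open>P n\<close> unfolding P_def by auto
    then show ?thesis using le d intermediateD(4) by blast
  qed
  ultimately have "P (GREATEST n. P n)" and max: "\<And>n. P n \<Longrightarrow> n \<le> (GREATEST n. P n)"
    using GreatestI_nat[of P m d] Greatest_le_nat[of P _ d] by blast+
  then obtain B n where B: "intermediate B" "M \<subseteq> B" "B \<subseteq> F" "value_set B = value_set M" "dimension n K B"
    and n: "n = (GREATEST n. P n)" unfolding P_def by blast
  have "B' = B" if B': "intermediate B'" "B \<subseteq> B'" "B' \<subseteq> F" "value_set B' = value_set M" for B'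
  proof -
    obtain n' where n': "dimension n' K B'" 
      using finite_dimension_intermediate[OF B'(1)] by (auto simp: finite_dimension_def)
    then have "P n'" using B' B(2) unfolding P_def by blast
    then have "n' \<le> n" unfolding n by (rule max)
    moreover have "n \<le> n'" using le B(5) n' B'(2) .
    ultimately have eq: "n' = n" by simp
    obtain Us where Us: "independent K Us" "length Us = n" "Span K Us = B" "set Us \<subseteq> carrier R"
      using exists_base[OF K B(5)] by auto
    then have "set Us \<subseteq> B'" using Span_base_incl[OF K Us(4)] B'(2) by auto
    then have "Span K Us = B'" using independent_length_eq_dimension[OF K n' Us(1)] Us(2) eq by simp
    then show ?thesis using Us(3) by simp
  qed
  then show ?thesis using B by blast
qed

text \<open>The element \<open>p\<close> plays the part of a uniformiser of \<open>L\<close> and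
  \<open>e\<close> that of the ramification index of \<open>L\<close> over \<open>K\<close>.

  Let \<open>B\<close> be maximal between \<open>M\<close> and \<open>F\<close> with the value group of
  \<open>M\<close>. Residually simple roots over \<open>B\<close> that lie in \<open>F\<close> already belong to
  \<open>B\<close>, so \<open>B \<inter> L\<close> meets every residue class of \<open>L\<close>. Multiplying
  \<open>p\<close> by a unit gives \<open>q\<close> in \<open>L\<close> with \<open>q ^ e\<close> in
  \<open>B\<close>. If \<open>n\<close> is the order of the value of \<open>q\<close> modulo the value group of
  \<open>B\<close>, then \<open>n\<close> divides \<open>e\<close> and maximality of \<open>B\<close> once more
  puts \<open>q ^ n\<close> into \<open>B\<close>, so the values of \<open>B(q)\<close> are known. Since
  \<open>B(q) \<inter> L\<close> has the same values and residues as \<open>L\<close>, it equals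
  \<open>L\<close>, and \<open>B(q) = F\<close>.\<close>

lemma value_set_tame_compositum:
  assumes L: "intermediate L" "L \<subseteq> F" and M: "intermediate M" "M \<subseteq> F" and F: "intermediate F"
    and generated: "\<And>C. intermediate C \<Longrightarrow> L \<subseteq> C \<Longrightarrow> M \<subseteq> C \<Longrightarrow> F \<subseteq> C"
    and sep: "residue_separable R v L K"
    and p: "p \<in> L" "p \<noteq> \<zero>" and e: "0 < e" "v ([e] \<cdot> \<one>) = 1" "v p ^ e \<in> value_set K"
    and L_values: "\<And>a. a \<in> value_set L \<Longrightarrow> \<exists>c\<in>value_set K. \<exists>i. a = c * v p ^ i"
    and gap: "0 < \<gamma>" "\<gamma> < 1" "\<And>a. a \<in> value_set (carrier R) \<Longrightarrow> a < 1 \<Longrightarrow> a \<le> \<gamma>"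
    and a: "a \<in> value_set F"
  shows "\<exists>c\<in>value_set M. \<exists>i. a = c * v p ^ i"
proof -
  note L' = intermediateD[OF L(1)] and F' = intermediateD[OF F]
  have Lc: "x \<in> carrier R" if "x \<in> L" for x using that L'(4) by blast
  have L_inv: "inv x \<in> L" if "x \<in> L" "x \<noteq> \<zero>" for x using subfield_m_inv(1)[OF L'(1)] that by blast
  have L_mult: "x \<otimes> y \<in> L" if "x \<in> L" "y \<in> L" for x y using subringE(6)[OF L'(3)] that by blast
  have L_pow: "x [^] n \<in> L" if "x \<in> L" for x and n :: nat
    using that subringE(3)[OF L'(3)] by (induction n) (auto intro: L_mult)
  obtain B where B: "intermediate B" "M \<subseteq> B" "B \<subseteq> F" "value_set B = value_set M"
    and maximal: "\<And>B'. intermediate B' \<Longrightarrow> B \<subseteq> B' \<Longrightarrow> B' \<subseteq> F \<Longrightarrow> value_set B' = value_set M \<Longrightarrow> B' = B"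
    using exists_maximal_extension_same_value_set[OF M F] by blast
  note B' = intermediateD[OF B(1)]
  have Bc: "x \<in> carrier R" if "x \<in> B" for x using that B'(4) by blast
  have B_inv: "inv x \<in> B" if "x \<in> B" "x \<noteq> \<zero>" for x using subfield_m_inv(1)[OF B'(1)] that by blast
  have B_mult: "x \<otimes> y \<in> B" if "x \<in> B" "y \<in> B" for x y using subringE(6)[OF B'(3)] that by blast
  have B_pow: "x [^] n \<in> B" if "x \<in> B" for x and n :: nat
    using that subringE(3)[OF B'(3)] by (induction n) (auto intro: B_mult)
  have root_in_B: "w \<in> B" if w: "w \<in> F" "residually_simple_root B w" for w
  proof -
    have wc: "w \<in> carrier R" using w F'(4) by blast
    have "simple_extension B w = B"
      using intermediate_simple_extension[OF B(1) wc] simple_extension_subset[OF F B(3) w(1)]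
        value_set_simple_extension[OF B(1) w(2)] B(4) by (intro maximal) auto
    then show ?thesis using intermediate_simple_extension(3)[OF B(1) wc] by simp
  qed
  have residues: "\<exists>s\<in>B \<inter> L. v (s \<ominus> x) < 1" if x: "x \<in> L" "v x \<le> 1" for x
    using exists_residually_simple_root_close[OF L(1) sep x] root_in_B residually_simple_root_mono[OF _ B'(2)] L(2)
    by blast
  have pc: "p \<in> carrier R" using Lc p by simp
  \<comment> \<open>Write \<open>p ^ e = k u\<close> with \<open>k\<close> in \<open>K\<close> and \<open>u\<close> a unit, and choose \<open>s\<close> in \<open>B \<inter> L\<close> close to \<open>u\<close>.  The one-unit \<open>w = u / s\<close> is an \<open>e\<close>-th power
    \<open>t ^ e\<close>, and \<open>q = p / t\<close> satisfies \<open>q ^ e = k s\<close>.\<close>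
  obtain q where q: "q \<in> L" "q \<noteq> \<zero>" "v q = v p" "q [^] e \<in> B"
  proof -
    obtain k where k: "k \<in> K" "k \<noteq> \<zero>" "v p ^ e = v k" using e(3) by (auto simp: value_set_def)
    have kL: "k \<in> L" "k \<in> B" "k \<in> carrier R" using k L'(2) B'(2) Lc by auto
    define u where "u = p [^] e \<otimes> inv k"
    have pe: "p [^] e \<in> L" "p [^] e \<in> carrier R" using L_pow p(1) Lc by auto
    have u: "u \<in> L" "u \<in> carrier R" using pe kL k L_mult L_inv Lc by (auto simp: u_def)
    have vu: "v u = 1" using pe kL k pc by (simp add: u_def)
    obtain s where s: "s \<in> B" "s \<in> L" "v (s \<ominus> u) < 1" using residues[of u] u vu by auto
    have sc: "s \<in> carrier R" using Lc s by simp
    have vs: "v s = 1" using v_eq_if_close[OF sc u(2)] s vu by simp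
    have s0: "s \<noteq> \<zero>" using vs by auto
    define w where "w = u \<otimes> inv s"
    have w: "w \<in> L" "w \<in> carrier R" "v w = 1" using u s s0 sc vu vs L_mult L_inv Lc by (auto simp: w_def)
    have "w \<ominus> \<one> = (u \<ominus> s) \<otimes> inv s"
    proof -
      have "(u \<ominus> s) \<otimes> inv s = u \<otimes> inv s \<ominus> s \<otimes> inv s" using u(2) sc s0 inv_carrier[OF sc s0] by algebra
      then show ?thesis using sc s0 by (simp add: w_def)
    qed
    then have "v (w \<ominus> \<one>) < 1" using u(2) sc s0 vs s(3) by (simp add: v_minus_commute)
    then obtain t where t: "t \<in> L" "t [^] e = w" "v (t \<ominus> \<one>) < 1"
      using exists_root_of_one_unit[OF L(1) w(1) _ e(1,2)] by blast
    have tc: "t \<in> carrier R" using Lc t by simp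
    have vt: "v t = 1" using v_eq_if_close[OF tc one_closed] t by simp
    have t0: "t \<noteq> \<zero>" using vt by auto
    have it: "inv t \<in> carrier R" using tc t0 by simp
    have "(p \<otimes> inv t) [^] e = p [^] e \<otimes> inv t [^] e" by (rule nat_pow_distrib[OF pc it])
    also have "inv t [^] e = inv w"
    proof -
      have "inv t [^] e \<otimes> t [^] e = \<one>"
        using nat_pow_distrib[OF it tc, of e] tc t0 by simp
      then show ?thesis using it w(2) t(2) by (intro comm_inv_char[symmetric]) (auto simp: m_comm)
    qed
    also have "inv w = s \<otimes> inv u"
    proof -
      have u0: "u \<noteq> \<zero>" using vu by auto
      have "(u \<otimes> inv s) \<otimes> (s \<otimes> inv u) = \<one>"
      proof -
        have "(u \<otimes> inv s) \<otimes> (s \<otimes> inv u) = (inv s \<otimes> s) \<otimes> (u \<otimes> inv u)"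
          using u(2) sc inv_carrier[OF sc s0] inv_carrier[OF u(2) u0] by algebra
        then show ?thesis using u(2) u0 sc s0 by simp
      qed
      then show ?thesis unfolding w_def
        using u(2) u0 sc s0 by (intro comm_inv_char) auto
    qed
    also have "p [^] e \<otimes> (s \<otimes> inv u) = k \<otimes> s"
    proof -
      have u0: "u \<noteq> \<zero>" using vu by auto
      have "k \<otimes> u = p [^] e \<otimes> (k \<otimes> inv k)"
        unfolding u_def using pe(2) kL(3) inv_carrier[OF kL(3) k(2)] by algebra
      then have "p [^] e = k \<otimes> u" using kL k pe by simp
      then have "p [^] e \<otimes> (s \<otimes> inv u) = k \<otimes> s \<otimes> (u \<otimes> inv u)"
        using kL(3) u(2) sc inv_carrier[OF u(2) u0] by (simp only:) algebra
      then show ?thesis using u u0 kL sc by simp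
    qed
    finally have "(p \<otimes> inv t) [^] e \<in> B" using B_mult kL s by simp
    moreover have "p \<otimes> inv t \<in> L" using L_mult p t L_inv t0 by simp
    moreover have vpt: "v (p \<otimes> inv t) = v p" using pc tc t0 vt by simp
    moreover have "p \<otimes> inv t \<noteq> \<zero>" using vpt v_eq_0_iff[OF pc] p(2) by (metis v_zero)
    ultimately show ?thesis using that by blast
  qed
  have qc: "q \<in> carrier R" using q Lc by simp
  have vq: "0 < v q" using v_pos_iff[OF qc] q(2) by blast
  define n where "n = (LEAST n. 0 < n \<and> v q ^ n \<in> value_set B)"
  have vqe: "v q ^ e \<in> value_set B"
    using q qc vq unfolding value_set_def by (intro image_eqI[of _ _ "q [^] e"]) (auto simp flip: v_eq_0_iff)
  have n: "0 < n" "v q ^ n \<in> value_set B"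
    using LeastI[of "\<lambda>n. 0 < n \<and> v q ^ n \<in> value_set B" e] vqe e(1) unfolding n_def by auto
  have n_min: "v q ^ i \<notin> value_set B" if "0 < i" "i < n" for i
    using not_less_Least[of i "\<lambda>n. 0 < n \<and> v q ^ n \<in> value_set B"] that unfolding n_def by blast
  have "n dvd e"
  proof -
    have "v q ^ e = (v q ^ n) ^ (e div n) * v q ^ (e mod n)"
      by (simp flip: power_mult power_add)
    then have "v q ^ (e mod n) = inverse ((v q ^ n) ^ (e div n)) * v q ^ e"
      using vq by (simp add: field_simps)
    then have "v q ^ (e mod n) \<in> value_set B"
      using value_set_subfield[OF B'(1)] vqe n(2) by metis
    then have "\<not> 0 < e mod n" using n_min n(1) by (meson mod_less_divisor)
    then show ?thesis by (simp add: mod_greater_zero_iff_not_dvd)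
  qed
  then obtain k where k: "e = n * k" by auto
  then have k0: "0 < k" using e(1) by (cases k) auto
  \<comment> \<open>Write \<open>q ^ n = c w\<close> with \<open>c\<close> in \<open>B\<close> and \<open>w\<close> a unit.  Then \<open>w\<close> is a root of \<open>X ^ k - w ^ k\<close> with \<open>w ^ k\<close> in \<open>B\<close>, and \<open>k\<close> is a unit,
    so \<open>w\<close> is a residually simple root.\<close>
  have "q [^] n \<in> B"
  proof -
    obtain c where c: "c \<in> B" "c \<noteq> \<zero>" "v q ^ n = v c" using n(2) by (auto simp: value_set_def)
    have cc: "c \<in> carrier R" "inv c \<in> B" "inv c \<in> carrier R" using c Bc B_inv by auto
    define w where "w = q [^] n \<otimes> inv c"
    have w: "w \<in> carrier R" "v w = 1" using qc cc c by (auto simp: w_def)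
    have "w [^] k = q [^] e \<otimes> (inv c) [^] k"
      using nat_pow_distrib[of "q [^] n" "inv c" k] qc cc by (simp add: w_def k nat_pow_pow)
    then have "w [^] k \<in> B" using q(4) B_mult B_pow cc by simp
    moreover have "v ([k] \<cdot> \<one>) = 1" using v_nat_dvd_eq_1[OF e(2)] k by simp
    ultimately have "residually_simple_root B w"
      using residually_simple_root_radical[OF B(1) w k0] by simp
    moreover have "w \<in> F"
    proof -
      have "q [^] n \<in> F" using L_pow[OF q(1)] L(2) by blast
      then show ?thesis using subringE(6)[OF F'(3)] cc B(3) unfolding w_def by blast
    qed
    ultimately have "w \<in> B" using root_in_B by simp
    then have "w \<otimes> c \<in> B" using B_mult c by simp
    moreover have "w \<otimes> c = q [^] n" using qc cc c by (simp add: w_def m_assoc)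
    ultimately show ?thesis by simp
  qed
  define E where "E = simple_extension B q"
  have E: "intermediate E" "B \<subseteq> E" "q \<in> E"
    unfolding E_def using intermediate_simple_extension[OF B(1) qc] by auto
  define D where "D = E \<inter> L"
  have D: "intermediate D" "D \<subseteq> L" unfolding D_def using intermediate_inter[OF E(1) L(1)] by auto
  note D' = intermediateD[OF D(1)]
  have D_mult: "x \<otimes> y \<in> D" if "x \<in> D" "y \<in> D" for x y using subringE(6)[OF D'(3)] that by blast
  have "L \<subseteq> D"
  proof (rule intermediate_subset_if_approximable[OF L(1) D gap(1,2)])
    fix x assume x: "x \<in> L"
    show "\<exists>y\<in>D. v (x \<ominus> y) \<le> \<gamma> * v x"
    proof (cases "x = \<zero>")
      case True
      then show ?thesis using subringE(2)[OF D'(3)] by (intro bexI[of _ \<zero>]) auto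
    next
      case False
      have xc: "x \<in> carrier R" using Lc x by simp
      have "v x \<in> value_set L" using x False by (auto simp: value_set_def)
      then obtain c i where c: "c \<in> value_set K" "v x = c * v p ^ i" using L_values by blast
      then obtain z where z: "z \<in> K" "z \<noteq> \<zero>" "c = v z" by (auto simp: value_set_def)
      have qD: "q \<in> D" using q E by (simp add: D_def)
      have "q [^] i \<in> D" using qD subringE(3)[OF D'(3)] by (induction i) (auto intro: D_mult)
      \<comment> \<open>\<open>g\<close> matches the value of \<open>x\<close>, and \<open>s\<close> the residue of \<open>x / g\<close>.\<close>
      define g where "g = z \<otimes> q [^] i"
      have g: "g \<in> D" "g \<in> L" "g \<in> carrier R" 
        using D_mult[of z "q [^] i"] \<open>q [^] i \<in> D\<close> z D'(2) D(2) Lc by (auto simp: g_def)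
      have zc: "z \<in> carrier R" using z L'(2) Lc by auto
      have vg: "v g = v x" using z zc c qc q(3) by (simp add: g_def)
      then have g0: "g \<noteq> \<zero>" using False xc by auto
      have ig: "inv g \<in> carrier R" "inv g \<in> L" using g g0 L_inv by auto
      define y where "y = x \<otimes> inv g"
      have y: "y \<in> L" "y \<in> carrier R" "v y = 1" 
        using x xc ig L_mult g g0 vg False by (auto simp: y_def)
      obtain s where s: "s \<in> B" "s \<in> L" "v (s \<ominus> y) < 1" using residues[of y] y by auto
      have sc: "s \<in> carrier R" and sD: "s \<in> D" using s E Lc by (auto simp: D_def)
      have xy: "x = y \<otimes> g" using xc g g0 ig by (simp add: y_def m_assoc)
      have diff: "x \<ominus> s \<otimes> g = (y \<ominus> s) \<otimes> g" unfolding xy using y(2) g(3) sc by algebra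
      have "v (y \<ominus> s) \<le> \<gamma>"
      proof (cases "y \<ominus> s = \<zero>")
        case False
        then have "v (y \<ominus> s) \<in> value_set (carrier R)" using y sc by (auto simp: value_set_def)
        then show ?thesis using gap(3) s(3) y(2) sc by (simp add: v_minus_commute)
      qed (use gap(1) in simp)
      then have "v (x \<ominus> s \<otimes> g) \<le> \<gamma> * v x"
        unfolding diff using y(2) sc g(3) xc by (simp add: vg mult_right_mono)
      then show ?thesis using D_mult[OF sD g(1)] by blast
    qed
  qed
  then have "F \<subseteq> E" using generated[OF E(1)] E(2) B(2) by (auto simp: D_def)
  then have "a \<in> value_set E" using a value_set_mono by blast
  then obtain c i where "c \<in> value_set B" "a = c * v q ^ i"
    using value_set_radical_extension[OF B'(1) qc q(2) n(1) \<open>q [^] n \<in> B\<close> n_min] unfolding E_def by blast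
  then show ?thesis using B(4) q(3) by auto
qed

end

theorem proposition1p4:
  fixes N :: "('a, 'b) ring_scheme"
    and K L M F :: "'a set"
    and absK absN :: "'a \<Rightarrow> real"
  assumes galois: "finite_galois_extension N K"
    and L: "intermediate_field N K L"
    and M: "intermediate_field N K M"
    and F: "intermediate_field N K F"
    and F_eq: "F = compositum N L M"
    and absK: "complete_discrete_abs (N \<lparr> carrier := K \<rparr>) absK"
    and absN: "nonarch_abs N absN"
    and extends: "\<And>x. x \<in> K \<Longrightarrow> absN x = absK x"
    and tame: "tamely_ramified N absN L K"
    and res_sep: "residue_separable N absN (carrier N) K"
  shows "ramification_index N absN (carrier N) F =
    gcd (ramification_index N absN (carrier N) L) (ramification_index N absN (carrier N) M)"
proof -
  have NK: "field N" "subfield K N" "ring.finite_dimension N K (carrier N)"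
    using galois by (auto simp: finite_galois_extension_def)
  have N: "ultrametric_field N absN"
    using NK(1) absN by (simp add: ultrametric_field_def ultrametric_field_axioms_def)
  have "ultrametric_field.complete_on N absN K"
    using absK ultrametric_field.complete_on_if_mcomplete[OF N subfieldE(1)[OF NK(2)] extends]
    by (simp add: complete_discrete_abs_def)
  then interpret complete_extension N absN K
    using NK N by (intro complete_extension.intro complete_extension_axioms.intro)
  note L' = intermediateD[OF L] and M' = intermediateD[OF M] and F' = intermediateD[OF F]
  have LM: "L \<subseteq> F" "M \<subseteq> F" unfolding F_eq compositum_def by (auto intro: generate_field.incl)
  have generated: "F \<subseteq> C" if "intermediate C" "L \<subseteq> C" "M \<subseteq> C" for C
    unfolding F_eq compositum_def
    using that L'(4) M'(4) intermediateD(1)[OF that(1)] by (intro generate_field_min_subfield1) auto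
  have "discrete (value_set K)"
  proof -
    have "carrier (value_group (N\<lparr>carrier := K\<rparr>) absK) = value_set K"
      using extends by (auto simp: value_group_def value_set_def)
    then show ?thesis using absK by (simp add: complete_discrete_abs_def)
  qed
  then obtain c where c: "0 < c" "c < 1" "\<And>a. a \<in> value_set (carrier N) \<Longrightarrow> a < 1 \<Longrightarrow> a \<le> c"
    using exists_value_gap by blast
  have sub: "value_set C \<subseteq> value_set (carrier N)" if "intermediate C" for C
    using value_set_mono intermediateD(4)[OF that] .
  have Ki: "intermediate K" using K by (simp add: intermediate_field_def)
  show ?thesis
  \<comment> \<open>If the absolute value is trivial, there is no uniformiser, and all ramification indices are 1.\<close>
  proof (cases "value_set (carrier N) = {1}")
    case True
    have "value_set C = {1}" if "intermediate C" for C
      using sub[OF that] value_set_subfield(1)[OF intermediateD(1)[OF that]] True by auto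
    then have "ramification_index N absN (carrier N) C = 1" if "intermediate C" for C
      using that True by (simp add: ramification_index_eq_card)
    then show ?thesis using L M F by simp
  next
    case False
    note Nv = value_set_subfield[OF carrier_is_subfield]
    obtain r where r: "0 < r" "r < 1" "value_set (carrier N) = zpowers r"
      using cyclic_if_gap[of "value_set (carrier N)" c] Nv(1-4) c False by blast
    obtain n where n: "0 < n" "\<And>a. a \<in> value_set (carrier N) \<Longrightarrow> a ^ n \<in> value_set K"
      using exists_common_exponent by auto
    have "r \<in> value_set (carrier N)" using power_mem_zpowers[of r 1] r(3) by simp
    then have rn: "r ^ n \<in> value_set K" by (rule n(2))
    have cyclic: "\<exists>m>0. value_set C = zpowers (r ^ m)" if C: "intermediate C" for C
    proof (rule subgroup_zpowers[OF r(1,2)])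
      show "value_set C \<subseteq> zpowers r" using sub[OF C] r(3) by simp
      show "0 < n" "r ^ n \<in> value_set C" using n rn value_set_mono[OF intermediateD(2)[OF C]] by auto
    qed (use value_set_subfield[OF intermediateD(1)[OF C]] in auto)
    obtain k where k: "0 < k" "value_set K = zpowers (r ^ k)" using cyclic[OF Ki] by blast
    obtain l where l: "0 < l" "value_set L = zpowers (r ^ l)" using cyclic[OF L] by blast
    obtain m where m: "0 < m" "value_set M = zpowers (r ^ m)" using cyclic[OF M] by blast
    obtain f where f: "0 < f" "value_set F = zpowers (r ^ f)" using cyclic[OF F] by blast
    have index: "ramification_index N absN (carrier N) C = j" if "value_set C = zpowers (r ^ j)" "0 < j" for C j
      unfolding ramification_index_eq_card that(1) r(3) by (rule card_cosets_zpowers[OF r(1,2) that(2)])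
    \<comment> \<open>The exponents \<open>l\<close>, \<open>m\<close>, \<open>f\<close> are thus the indices of \<open>N\<close> over \<open>L\<close>, \<open>M\<close>, \<open>F\<close>, and \<open>e = k / l\<close> is that of \<open>L\<close> over \<open>K\<close>.\<close>
    have "r ^ k \<in> value_set L"
      using k power_mem_zpowers[of "r ^ k" 1] value_set_mono[OF L'(2)] by auto
    then have "l dvd k" unfolding l(2) zpowers_subset_iff_dvd[OF r(1,2)] .
    then obtain e where e: "k = l * e" by auto
    have e0: "0 < e" using k(1) e by (cases e) auto
    have rl: "0 < r ^ l" "r ^ l < 1" using r l by (auto simp: power_less_one_iff)
    have K_eq: "value_set K = zpowers ((r ^ l) ^ e)" by (simp add: k(2) e power_mult)
    have "ramification_index N absN L K = e"
      unfolding ramification_index_eq_card K_eq l(2) by (rule card_cosets_zpowers[OF rl e0])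
    then have sep: "residue_separable N absN L K" and ve: "absN ([e] \<cdot>\<^bsub>N\<^esub> \<one>\<^bsub>N\<^esub>) = 1"
      using tame v_nat_eq_1[OF K e0] by (auto simp: tamely_ramified_def Let_def)
    have "r ^ l \<in> value_set L" using l(2) power_mem_zpowers[of "r ^ l" 1] by simp
    then obtain p where p: "p \<in> L" "p \<noteq> \<zero>\<^bsub>N\<^esub>" "absN p = r ^ l"
      unfolding value_set_def by (metis DiffD1 DiffD2 imageE singletonI)
    have L_values: "\<exists>c\<in>value_set K. \<exists>i. a = c * absN p ^ i" if "a \<in> value_set L" for a
    proof -
      obtain j where j: "a = (r ^ l) powi j" using \<open>a \<in> value_set L\<close> l(2) by (auto simp: zpowers_def)
      define i where "i = nat (j mod int e)"
      have i: "int i = j mod int e" using e0 by (simp add: i_def)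
      have "j = int e * (j div int e) + int i" unfolding i by simp
      then have "a = (r ^ l) powi (int e * (j div int e) + int i)" using j by simp
      also have "\<dots> = ((r ^ l) ^ e) powi (j div int e) * (r ^ l) ^ i"
        using rl(1) by (subst power_int_add) (auto simp only: power_int_mult power_int_of_nat)
      finally show ?thesis unfolding K_eq p(3) by (auto simp: zpowers_def)
    qed
    have pe: "absN p ^ e \<in> value_set K"
      unfolding p(3) K_eq using power_mem_zpowers[of "(r ^ l) ^ e" 1] by simp
    have F_values: "\<exists>c\<in>value_set M. \<exists>i. a = c * absN p ^ i" if "a \<in> value_set F" for a
      using value_set_tame_compositum[OF L LM(1) M LM(2) F generated sep p(1,2) e0 ve pe L_values c that] .
    have "f = gcd l m"
    proof (rule dvd_antisym)
      have "r ^ l \<in> value_set F" "r ^ m \<in> value_set F"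
        using l m power_mem_zpowers[of "r ^ l" 1] power_mem_zpowers[of "r ^ m" 1]
          value_set_mono[OF LM(1)] value_set_mono[OF LM(2)] by auto
      then show "f dvd gcd l m" unfolding f(2) zpowers_subset_iff_dvd[OF r(1,2)] by simp
      have "r ^ f \<in> value_set F" using f(2) power_mem_zpowers[of "r ^ f" 1] by simp
      then obtain b i where b: "b \<in> value_set M" "r ^ f = b * (r ^ l) ^ i"
        using F_values[of "r ^ f"] p(3) by auto
      have "b \<in> zpowers (r ^ gcd l m)" "(r ^ l) ^ i \<in> zpowers (r ^ gcd l m)"
        using b(1) m(2) zpowers_power_subset[of "gcd l m" m r] zpowers_power_subset[of "gcd l m" l r]
          power_mem_zpowers[of "r ^ l" i] by auto
      then have "r ^ f \<in> zpowers (r ^ gcd l m)"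
        unfolding b(2) using r by (intro zpowers_mult_closed) auto
      then show "gcd l m dvd f" unfolding zpowers_subset_iff_dvd[OF r(1,2)] .
    qed
    then show ?thesis using index[OF f(2,1)] index[OF l(2,1)] index[OF m(2,1)] by simp
  qed
qed

end
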